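(* Let $d\geq 3$ be an integer, put $m=d-2$, and fix $e\in S^{d-1}$. Let $F\subset\mathbb{R}^d$ be compact, and let $\mu$ be a (Borel) probability measure on $F$ for which there are a constant $C_\mu<\infty$ and a real number $q>m+1$ such that $$\mu(B(x,r))\leq C_\mu r^q\qquad\text{for all } x\in\mathbb{R}^d,\ r>0.$$ Then for every $0<t<q-m$, for $\gamma_e$-almost every $P\in\mathcal{P}_e$ there is a set $Y_P\subset P^\perp$ of positive $\mathcal{H}^m$ measure such that $$\dim_{\mathrm H}(F\cap(y+P))\geq t\qquad\text{for all } y\in Y_P.$$
   Context: $S^{d-1}$ is the unit sphere of $\mathbb{R}^d$, $B(x,r)$ is the ball of center $x$ and radius $r$, $\dim_{\mathrm H}$ denotes Hausdorff dimension, and $\mathcal{H}^m$ denotes $m$-dimensional Hausdorff measure. $G(d,2)$ is the Grassmannian of $2$-dimensional linear subspaces of $\mathbb{R}^d$; $P^\perp$ is the orthogonal complement of $P$ in $\mathbb{R}^d$ (of dimension $m=d-2$ when $P\in G(d,2)$). For $e\in S^{d-1}$, let $$\mathcal{P}_e=\{P\in G(d,2): e\in P\}.$$ Let $H=e^\perp\cong\mathbb{R}^{d-1}$ and let $G(H,1)\cong G(d-1,1)$ be the set of $1$-dimensional linear subspaces of $H$, equipped with its unique rotation-invariant (under the orthogonal group of $H$) Borel probability measure. The probability measure $\gamma_e$ on $\mathcal{P}_e$ is the pushforward of this invariant measure under the map $\ell\mapsto \mathbb{R}e\oplus\ell$. *)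

theory Defs
  imports "HOL-Probability.Probability"
begin

section \<open>Hausdorff measure and Hausdorff dimension\<close>

text \<open>
  The summand \<open>(diam U)\<^sup>s\<close>, as an extended nonnegative real. The case distinction fixes the
  conventions \<open>(diam {})\<^sup>s = 0\<close> and \<open>0\<^sup>0 = 1\<close> for nonempty sets (whereas \<open>0 powr 0 = 0\<close>), so that
  the measure with \<open>s = 0\<close> is the counting measure.
\<close>

definition diam_pow :: "real \<Rightarrow> 'a::metric_space set \<Rightarrow> ennreal" where
  "diam_pow s U =
    (if U = {} then 0 else if s = 0 then 1 else ennreal (diameter U powr s))"

text \<open>
  Covers consist of bounded sets, because \<^const>\<open>diameter\<close> is real-valued and unspecified on
  unbounded sets.
\<close>

definition hausdorff_premeasure :: "real \<Rightarrow> real \<Rightarrow> 'a::metric_space set \<Rightarrow> ennreal" where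
  "hausdorff_premeasure s \<delta> A =
    (INF U \<in> {U :: nat \<Rightarrow> 'a set. A \<subseteq> (\<Union>i. U i) \<and> (\<forall>i. bounded (U i) \<and> diameter (U i) \<le> \<delta>)}.
      (\<Sum>i. diam_pow s (U i)))"

text \<open>
  This is the Hausdorff outer measure, defined on all subsets, without a normalising constant.
\<close>

definition hausdorff_measure :: "real \<Rightarrow> 'a::metric_space set \<Rightarrow> ennreal" where
  "hausdorff_measure s A = (SUP \<delta>\<in>{0<..}. hausdorff_premeasure s \<delta> A)"

definition hausdorff_dim :: "'a::metric_space set \<Rightarrow> ereal" where
  "hausdorff_dim A = (INF s\<in>{s. 0 \<le> s \<and> hausdorff_measure s A = 0}. ereal s)"


section \<open>Grassmannians and the measure on planes through a direction\<close>

definition grassmannian :: "(real^'n) set \<Rightarrow> nat \<Rightarrow> (real^'n) set set" where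
  "grassmannian H k = {V. subspace V \<and> V \<subseteq> H \<and> dim V = k}"

text \<open>
  The usual topology on a set of linear subspaces: a subspace \<open>V\<close> is identified with the matrix of
  the orthogonal projection onto \<open>V\<close>, which is \<^term>\<open>closest_point V\<close>.
\<close>

definition subspaces_topology :: "(real^'n) set set \<Rightarrow> (real^'n) set topology" where
  "subspaces_topology S = pullback_topology S (\<lambda>V. matrix (closest_point V)) euclidean"

definition subspaces_borel :: "(real^'n) set set \<Rightarrow> (real^'n) set measure" where
  "subspaces_borel S = sigma S {U. openin (subspaces_topology S) U}"

text \<open>
  Every linear isometry of a subspace \<open>H\<close> extends to an orthogonal transformation of the whole
  space that preserves \<open>H\<close>; the orthogonal group of \<open>H\<close> is represented by these extensions.
\<close>

definition orthogonal_group :: "(real^'n) set \<Rightarrow> (real^'n \<Rightarrow> real^'n) set" where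
  "orthogonal_group H = {g. orthogonal_transformation g \<and> g ` H = H}"

text \<open>
  \<open>\<nu>\<close> is a rotation-invariant Borel probability measure on the set of lines in \<open>H\<close>; there is exactly
  one such \<open>\<nu>\<close> when \<open>H \<noteq> {0}\<close> (for existence see \<open>ex_invariant_line_measure\<close> below).
\<close>

definition invariant_line_measure :: "(real^'n) set \<Rightarrow> (real^'n) set measure \<Rightarrow> bool" where
  "invariant_line_measure H \<nu> \<longleftrightarrow>
    sets \<nu> = sets (subspaces_borel (grassmannian H 1)) \<and>
    prob_space \<nu> \<and>
    (\<forall>g\<in>orthogonal_group H. distr \<nu> \<nu> (\<lambda>l. g ` l) = \<nu>)"

definition planes_through :: "real^'n \<Rightarrow> (real^'n) set set" where
  "planes_through e = {P \<in> grassmannian UNIV 2. e \<in> P}"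

definition planes_through_measure ::
    "real^'n \<Rightarrow> (real^'n) set measure \<Rightarrow> (real^'n) set measure" where
  "planes_through_measure e \<nu> = distr \<nu> (subspaces_borel (planes_through e)) (\<lambda>l. span {e} + l)"


section \<open>Existence of the invariant measure and measurability of the pushforward map\<close>

lemma closest_point_subspaceI:
  fixes V :: "(real^'n) set"
  assumes "subspace V" "a \<in> V" "\<And>v. v \<in> V \<Longrightarrow> (x - a) \<bullet> v = 0"
  shows "closest_point V x = a"
proof -
  have "dist x a \<le> dist x z" if "z \<in> V" for z
  proof -
    have "a - z \<in> V" using assms that subspace_diff by blast
    hence "(x - a) \<bullet> (a - z) = 0" using assms(3) by blast
    hence "(norm (x - z))\<^sup>2 = (norm (x - a))\<^sup>2 + (norm (a - z))\<^sup>2"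
      using norm_add_Pythagorean[of "x - a" "a - z"] by (simp add: orthogonal_def)
    thus ?thesis unfolding dist_norm by (smt (verit) norm_ge_zero power2_le_imp_le zero_le_power2)
  qed
  thus ?thesis
    using closest_point_unique[of V a x] assms closed_subspace subspace_imp_convex by metis
qed

lemma closest_point_span1:
  fixes v :: "real^'n"
  assumes "v \<noteq> 0"
  shows "closest_point (span {v}) x = ((x \<bullet> v) / (v \<bullet> v)) *\<^sub>R v"
  by (rule closest_point_subspaceI[OF subspace_span])
     (use assms in \<open>auto simp: span_singleton inner_diff_left\<close>)

lemma closest_point_subspaceE:
  fixes V :: "(real^'n) set"
  assumes "subspace V"
  shows "closest_point V x \<in> V" "\<And>v. v \<in> V \<Longrightarrow> (x - closest_point V x) \<bullet> v = 0"
proof -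
  have "x \<in> V + V\<^sup>\<bottom>" using subspace_sum_orthogonal_comp[OF assms] by auto
  then obtain a b where ab: "a \<in> V" "b \<in> V\<^sup>\<bottom>" "x = a + b" by (auto simp: set_plus_def)
  have *: "closest_point V x = a"
    by (rule closest_point_subspaceI)
      (use assms ab in \<open>auto simp: orthogonal_comp_def orthogonal_def inner_commute\<close>)
  show "closest_point V x \<in> V" using * ab by simp
  show "(x - closest_point V x) \<bullet> v = 0" if "v \<in> V" for v
    using * ab that by (auto simp: orthogonal_comp_def orthogonal_def inner_commute)
qed

lemma linear_closest_point:
  fixes V :: "(real^'n) set"
  assumes "subspace V"
  shows "linear (closest_point V)"
proof (rule linearI)
  note E = closest_point_subspaceE[OF assms]
  fix x y :: "real^'n" and c :: real
  show "closest_point V (x + y) = closest_point V x + closest_point V y"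
  proof (rule closest_point_subspaceI[OF assms])
    fix v assume v: "v \<in> V"
    show "(x + y - (closest_point V x + closest_point V y)) \<bullet> v = 0"
      using E(2)[OF v, where x=x] E(2)[OF v, where x=y] by (simp add: inner_diff_left inner_add_left)
  qed (use E(1) assms in \<open>auto simp: subspace_add\<close>)
  show "closest_point V (c *\<^sub>R x) = c *\<^sub>R closest_point V x"
  proof (rule closest_point_subspaceI[OF assms])
    fix v assume v: "v \<in> V"
    have "(c *\<^sub>R x - c *\<^sub>R closest_point V x) \<bullet> v = c * ((x - closest_point V x) \<bullet> v)"
      by (simp add: inner_diff_left algebra_simps)
    thus "(c *\<^sub>R x - c *\<^sub>R closest_point V x) \<bullet> v = 0" using E(2)[OF v] by simp
  qed (use E(1) assms in \<open>auto simp: subspace_scale\<close>)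
qed

lemma space_subspaces_borel [simp]: "space (subspaces_borel S) = S"
  and sets_subspaces_borel:
    "sets (subspaces_borel S) = sigma_sets S {(\<lambda>V. matrix (closest_point V)) -` W \<inter> S |W. open W}"
proof -
  have *: "{U. openin (subspaces_topology S) U} =
      {(\<lambda>V. matrix (closest_point V)) -` W \<inter> S |W. open W}"
    unfolding subspaces_topology_def openin_pullback_topology by auto
  have "{U. openin (subspaces_topology S) U} \<subseteq> Pow S" unfolding * by auto
  thus "space (subspaces_borel S) = S"
   "sets (subspaces_borel S) = sigma_sets S {(\<lambda>V. matrix (closest_point V)) -` W \<inter> S |W. open W}"
    unfolding subspaces_borel_def by (simp_all add: *)
qed

lemma measurable_subspaces_borelI:
  assumes "(\<lambda>x. matrix (closest_point (f x))) \<in> borel_measurable M" "f \<in> space M \<rightarrow> S"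
  shows "f \<in> measurable M (subspaces_borel S)"
proof (rule measurable_sigma_sets[OF sets_subspaces_borel])
  show "{(\<lambda>V. matrix (closest_point V)) -` W \<inter> S |W. open W} \<subseteq> Pow S" by auto
  show "f \<in> space M \<rightarrow> S" by fact
  fix y assume "y \<in> {(\<lambda>V. matrix (closest_point V)) -` W \<inter> S |W. open W}"
  then obtain W where W: "open W" "y = (\<lambda>V. matrix (closest_point V)) -` W \<inter> S" by auto
  have "f -` y \<inter> space M = (\<lambda>x. matrix (closest_point (f x))) -` W \<inter> space M"
    using assms(2) W by auto
  also have "\<dots> \<in> sets M" using assms(1) W by (auto intro: measurable_sets)
  finally show "f -` y \<inter> space M \<in> sets M" .
qed

lemma measurable_matrix_closest_point:
  "(\<lambda>V. matrix (closest_point V)) \<in> borel_measurable (subspaces_borel S)"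
  by (rule borel_measurableI) (auto simp: sets_subspaces_borel)

lemma distr_lborel_orthogonal:
  fixes g :: "real^'n \<Rightarrow> real^'n"
  assumes g: "orthogonal_transformation g"
  shows "distr lborel borel g = lborel"
proof (rule measure_eqI_generator_eq[where E="{U. open U}" and \<Omega>=UNIV and A="\<lambda>n. ball 0 (real n)"])
  have lin: "linear g" using g orthogonal_transformation_linear by blast
  have gm: "g \<in> borel_measurable borel"
    using lin linear_continuous_on linear_linear borel_measurable_continuous_onI by blast
  have bij: "bij g" using g orthogonal_transformation_bij by blast
  have isom: "dist (g x) (g y) = dist x y" for x y
    using g orthogonal_transformation_isometry by blast
  obtain h where h: "orthogonal_transformation h" "\<And>x. h (g x) = x" "\<And>x. g (h x) = x"
    using orthogonal_transformation_inv[OF g] bij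
    by (metis bij_inv_eq_iff)
  have hlin: "linear h" using h orthogonal_transformation_linear by blast
  have vb: "g -` ball c r = ball (h c) r" for c r
    using isom h by (auto simp: mem_ball) (metis h(3) isom)+
  show "Int_stable {U::(real^'n) set. open U}" by (auto simp: Int_stable_def)
  show "{U::(real^'n) set. open U} \<subseteq> Pow UNIV" by auto
  show "sets (distr lborel borel g) = sigma_sets UNIV {U. open U}"
    by (simp add: borel_def)
  show "sets lborel = sigma_sets UNIV {U::(real^'n) set. open U}"
    by (simp add: borel_def)
  show "range (\<lambda>n. ball (0::real^'n) (real n)) \<subseteq> {U. open U}" by auto
  show "(\<Union>i. ball (0::real^'n) (real i)) = UNIV"
    by (auto simp: reals_Archimedean2)
  have eb: "emeasure (distr lborel borel g) (ball c r) = emeasure lborel (ball c r)" for c :: "real^'n" and r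
  proof (cases "r \<ge> 0")
    case True
    thus ?thesis by (simp add: emeasure_distr gm vb emeasure_ball)
  qed (simp add: ball_empty)
  show "emeasure (distr lborel borel g) (ball 0 (real i)) \<noteq> \<infinity>" for i
    using eb by (simp add: emeasure_ball)
  fix X :: "(real^'n) set" assume "X \<in> {U. open U}"
  hence X: "open X" by simp
  obtain C where C: "countable C" "C \<subseteq> {(c,r). ball c r \<subseteq> X \<and> 0 < r}"
     "pairwise (\<lambda>i j. disjnt (ball (fst i) (snd i)) (ball (fst j) (snd j))) C"
     "negligible (X - (\<Union>i\<in>C. ball (fst i) (snd i)))"
  proof (rule Vitali_covering_theorem_balls[of X "{(c,r). ball c r \<subseteq> X \<and> 0 < r}" fst snd])
    fix x d assume "x \<in> X" "(0::real) < d"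
    then obtain r where "r > 0" "ball x r \<subseteq> X" using X openE by blast
    thus "\<exists>i. i \<in> {(c, r). ball c r \<subseteq> X \<and> 0 < r} \<and> x \<in> ball (fst i) (snd i) \<and> snd i < d"
      using \<open>d > 0\<close> by (intro exI[of _ "(x, min r (d/2))"]) auto
  qed auto
  let ?B = "\<lambda>i. ball (fst i) (snd i)"
  let ?N = "X - (\<Union>i\<in>C. ?B i)"
  have Nb: "?N \<in> sets borel" using X C(1) by (auto intro!: sets.Diff)
  have N0: "?N \<in> null_sets lborel"
    using C(4) Nb by (simp add: negligible_iff_null_sets null_sets_completion_iff)
  have gN: "g -` Z = h ` Z" for Z
  proof
    show "g -` Z \<subseteq> h ` Z" using h(2) by (metis imageI subsetI vimageE)
    show "h ` Z \<subseteq> g -` Z" using h(3) by auto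
  qed
  have "negligible (h ` ?N)"
    using C(4) by (rule negligible_differentiable_image_negligible[rotated])
      (auto intro: linear_imp_differentiable_on hlin)
  hence hN: "h ` ?N \<in> null_sets lebesgue" by (simp only: negligible_iff_null_sets)
  have "g -` ?N \<in> sets borel" using measurable_sets[OF gm Nb] by simp
  hence "h ` ?N \<in> sets lborel" using gN[of ?N] by simp
  hence "h ` ?N \<in> null_sets lborel" using hN null_sets_completion_iff by blast
  hence "emeasure lborel (g -` ?N) = 0" using gN[of ?N] by (simp only: null_setsD1)
  hence gN0: "emeasure (distr lborel borel g) ?N = 0"
    using gm Nb by (subst emeasure_distr) auto
  have XC: "X = (\<Union>i\<in>C. ?B i) \<union> ?N" using C(2) by fastforce
  have dis: "disjoint_family_on ?B C"
    using C(3) by (auto simp: disjoint_family_on_def pairwise_def disjnt_def)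
  have E: "emeasure M X = (\<integral>\<^sup>+i. emeasure M (?B i) \<partial>count_space C)"
    if M: "sets M = sets borel" "emeasure M ?N = 0" for M :: "(real^'n) measure"
  proof -
    have "emeasure M X = emeasure M (\<Union>i\<in>C. ?B i)"
    proof -
      have U: "(\<Union>i\<in>C. ?B i) \<in> sets M" unfolding M(1) by (intro borel_open open_UN) auto
      have "emeasure M ((\<Union>i\<in>C. ?B i) \<union> ?N) = emeasure M (\<Union>i\<in>C. ?B i)"
        using U Nb M by (intro emeasure_Un_null_set) (auto simp: null_sets_def)
      thus ?thesis using XC by simp
    qed
    also have "\<dots> = (\<integral>\<^sup>+i. emeasure M (?B i) \<partial>count_space C)"
      using C(1) dis M by (intro emeasure_UN_countable) auto
    finally show ?thesis .
  qed
  show "emeasure (distr lborel borel g) X = emeasure lborel X"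
    using N0 by (simp add: E gN0 eb null_setsD1)
qed

lemma matrix_span1:
  fixes v :: "real^'n"
  assumes "v \<noteq> 0"
  shows "matrix (closest_point (span {v})) = (\<chi> i j. (v $ i * v $ j) / (v \<bullet> v))"
  using assms by (simp add: closest_point_span1 matrix_def inner_axis' vec_eq_iff)

lemma image_grassmannian:
  assumes g: "g \<in> orthogonal_group H" and l: "l \<in> grassmannian H k"
  shows "g ` l \<in> grassmannian H k"
proof -
  have lin: "linear g" and inj: "inj g"
    using g orthogonal_transformation_linear orthogonal_transformation_inj by (auto simp: orthogonal_group_def)
  show ?thesis
    using l g lin inj dim_image_eq[of g l] linear_subspace_image[of g l]
    by (auto simp: grassmannian_def orthogonal_group_def intro: inj_on_subset)
qed

lemma closest_point_image:
  fixes g :: "real^'n \<Rightarrow> real^'n"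
  assumes g: "orthogonal_transformation g" and l: "subspace l"
  shows "closest_point (g ` l) (g x) = g (closest_point l x)"
proof (rule closest_point_subspaceI)
  have lin: "linear g" using g orthogonal_transformation_linear by blast
  show "subspace (g ` l)" using lin l linear_subspace_image by blast
  show "g (closest_point l x) \<in> g ` l" using closest_point_subspaceE[OF l] by blast
  fix v assume "v \<in> g ` l"
  then obtain w where w: "w \<in> l" "v = g w" by auto
  have "(g x - g (closest_point l x)) \<bullet> v = g (x - closest_point l x) \<bullet> g w"
    using lin w by (simp add: linear_diff)
  also have "\<dots> = (x - closest_point l x) \<bullet> w"
    using g by (simp add: orthogonal_transformation_def)
  also have "\<dots> = 0" using closest_point_subspaceE[OF l] w by blast
  finally show "(g x - g (closest_point l x)) \<bullet> v = 0" .
qed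

lemma measurable_image:
  fixes H :: "(real^'n) set"
  assumes g: "g \<in> orthogonal_group H"
  shows "(\<lambda>l. g ` l) \<in> measurable (subspaces_borel (grassmannian H k)) (subspaces_borel (grassmannian H k))"
proof (rule measurable_subspaces_borelI)
  have go: "orthogonal_transformation g" using g by (auto simp: orthogonal_group_def)
  have lin: "linear g" using go orthogonal_transformation_linear by blast
  obtain h where h: "orthogonal_transformation h" "\<And>x. h (g x) = x" "\<And>x. g (h x) = x"
    using orthogonal_transformation_inv[OF go] orthogonal_transformation_bij[OF go]
    by (metis bij_inv_eq_iff)
  have hlin: "linear h" using h orthogonal_transformation_linear by blast
  let ?A = "subspaces_borel (grassmannian H k)"
  have "(\<lambda>V. matrix g ** matrix (closest_point V) ** matrix h) \<in> borel_measurable ?A"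
  proof -
    have "continuous_on UNIV (\<lambda>M. matrix g ** M ** matrix h)"
      unfolding matrix_matrix_mult_def by (intro continuous_intros)
    from measurable_compose[OF measurable_matrix_closest_point borel_measurable_continuous_onI[OF this]]
    show ?thesis .
  qed
  also have "?this \<longleftrightarrow> (\<lambda>V. matrix (closest_point (g ` V))) \<in> borel_measurable ?A"
  proof (rule measurable_cong)
    fix V assume "V \<in> space ?A"
    hence V: "subspace V" by (simp add: grassmannian_def)
    have eq: "closest_point (g ` V) = g \<circ> closest_point V \<circ> h"
      using closest_point_image[OF go V] h by (metis comp_apply ext)
    show "matrix g ** matrix (closest_point V) ** matrix h = matrix (closest_point (g ` V))"
      unfolding eq using linear_closest_point[OF V] lin hlin
      by (simp add: matrix_compose linear_compose)
  qed
  finally show "(\<lambda>V. matrix (closest_point (g ` V))) \<in> borel_measurable ?A" .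
  show "(`) g \<in> space ?A \<rightarrow> grassmannian H k" using image_grassmannian[OF g] by auto
qed

lemma ex_invariant_line_measure:
  fixes H :: "(real^'n) set"
  assumes H: "subspace H" "H \<noteq> {0}"
  shows "\<exists>\<nu>. invariant_line_measure H \<nu>"
proof -
  let ?p = "closest_point H"
  let ?A = "subspaces_borel (grassmannian H 1)"
  let ?U = "uniform_measure lborel (ball (0::real^'n) 1)"
  obtain b where b: "b \<in> H" "b \<noteq> 0" using H subspace_0 by blast
  define f where "f x = span {if ?p x = 0 then b else ?p x}" for x
  note pE = closest_point_subspaceE[OF H(1)]
  have plin: "linear ?p" using linear_closest_point[OF H(1)] .
  have pm [measurable]: "?p \<in> borel_measurable borel"
    using plin linear_continuous_on linear_linear borel_measurable_continuous_onI by blast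
  have spL: "span {v} \<in> grassmannian H 1" if "v \<in> H" "v \<noteq> 0" for v
    using that H by (auto simp: grassmannian_def span_minimal dim_singleton)
  have fm: "f \<in> measurable borel ?A"
  proof (rule measurable_subspaces_borelI)
    let ?q = "\<lambda>x. if ?p x = 0 then b else ?p x"
    have q: "?q \<in> borel_measurable borel" by measurable
    have "(\<lambda>x. matrix (closest_point (f x))) = (\<lambda>x. (\<chi> i j. (?q x $ i * ?q x $ j) / (?q x \<bullet> ?q x)))"
      unfolding f_def using b by (subst matrix_span1) auto
    also have "\<dots> \<in> borel_measurable borel"
    proof -
      have "(\<lambda>x. (?q x $ i * ?q x $ j) / (?q x \<bullet> ?q x)) \<in> borel_measurable borel" for i j
      proof -
        have "(\<lambda>x. ?q x $ k) \<in> borel_measurable borel" for k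
          using measurable_compose[OF q borel_measurable_continuous_onI[of "\<lambda>v. v $ k"]]
          by (simp add: continuous_intros)
        thus ?thesis using q by (intro borel_measurable_divide borel_measurable_times borel_measurable_inner)
      qed
      thus ?thesis
        by (subst borel_measurable_euclidean_space) (auto simp: Basis_vec_def inner_axis)
    qed
    finally show "(\<lambda>x. matrix (closest_point (f x))) \<in> borel_measurable borel" .
    show "f \<in> space borel \<rightarrow> grassmannian H 1" unfolding f_def using spL b pE(1) by auto
  qed
  hence fU: "f \<in> measurable ?U ?A" by (simp add: measurable_cong_sets[of ?U borel])
  have U: "prob_space ?U"
    by (rule prob_space_uniform_measure) (use unit_ball_vol_pos[of "real CARD('n)"] in \<open>auto simp: emeasure_ball simp del: unit_ball_vol_pos\<close>)
  let ?\<nu> = "distr ?U ?A f"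
  have "distr ?\<nu> ?\<nu> (\<lambda>l. g ` l) = ?\<nu>" if g: "g \<in> orthogonal_group H" for g
  proof -
    have go: "orthogonal_transformation g" and gH: "g ` H = H" using g by (auto simp: orthogonal_group_def)
    have lin: "linear g" using go orthogonal_transformation_linear by blast
    have gm: "g \<in> borel_measurable borel"
      using lin linear_continuous_on linear_linear borel_measurable_continuous_onI by blast
    have gU: "g \<in> measurable ?U ?U" using gm by (simp add: measurable_cong_sets[of ?U borel ?U borel])
    have pg: "?p (g x) = g (?p x)" for x using closest_point_image[OF go H(1)] gH by metis
    have g0: "g x = 0 \<longleftrightarrow> x = 0" for x
      using lin orthogonal_transformation_inj[OF go] by (metis injD linear_0)
    have gU_eq: "distr ?U ?U g = ?U"
    proof (rule measure_eqI)
      fix X assume "X \<in> sets (distr ?U ?U g)"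
      hence X: "X \<in> sets borel" by simp
      have gX: "g -` X \<in> sets borel" using measurable_sets[OF gm X] by simp
      have "ball 0 1 \<inter> g -` X = g -` (ball 0 1 \<inter> X)"
        using go by (auto simp: orthogonal_transformation)
      hence "emeasure lborel (ball 0 1 \<inter> g -` X) = emeasure (distr lborel borel g) (ball 0 1 \<inter> X)"
        using X gm by (simp add: emeasure_distr)
      also have "\<dots> = emeasure lborel (ball 0 1 \<inter> X)"
        by (simp add: distr_lborel_orthogonal[OF go])
      finally show "emeasure (distr ?U ?U g) X = emeasure ?U X"
        using X gX gU by (simp add: emeasure_distr)
    qed simp
    have "distr ?\<nu> ?\<nu> (\<lambda>l. g ` l) = distr ?\<nu> ?A (\<lambda>l. g ` l)" by (rule distr_cong) auto
    also have "\<dots> = distr ?U ?A ((\<lambda>l. g ` l) \<circ> f)"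
      using measurable_image[OF g] fU by (intro distr_distr) auto
    also have "\<dots> = distr ?U ?A (f \<circ> g)"
    proof (rule distr_cong_AE)
      let ?Z = "{x. ?p x = 0}"
      have Z: "subspace ?Z" using plin by (auto simp: subspace_def linear_0 linear_add linear_scale)
      have bZ: "b \<notin> ?Z" using b by (simp add: closest_point_self)
      have "dim ?Z < DIM(real^'n)"
      proof (rule ccontr)
        assume "\<not> dim ?Z < DIM(real^'n)"
        hence "dim ?Z = DIM(real^'n)" using dim_subset_UNIV[of ?Z] by simp
        hence "span ?Z = UNIV" by (simp only: dim_eq_full)
        hence "?Z = UNIV" using Z by (simp only: span_eq_iff[THEN iffD2])
        thus False using bZ by (simp only: UNIV_I not_True_eq_False)
      qed
      hence "negligible ?Z" by (rule negligible_lowdim)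
      moreover have "?Z \<in> sets borel" by measurable
      ultimately have "?Z \<in> null_sets lborel" by (simp add: negligible_iff_null_sets null_sets_completion_iff)
      hence "AE x in lborel. ?p x \<noteq> 0" by (rule AE_I'[of ?Z]) auto
      hence "AE x in ?U. ?p x \<noteq> 0" by (intro AE_uniform_measureI) auto
      thus "AE x in ?U. ((\<lambda>l. g ` l) \<circ> f) x = (f \<circ> g) x"
        by eventually_elim (auto simp: f_def pg g0 linear_span_image[OF lin, symmetric])
      show "(\<lambda>l. g ` l) \<circ> f \<in> measurable ?U ?A" using fU measurable_image[OF g] by (rule measurable_comp)
      show "f \<circ> g \<in> measurable ?U ?A" using gU fU by (rule measurable_comp)
    qed auto
    also have "\<dots> = distr (distr ?U ?U g) ?A f"
      using gU fU by (intro distr_distr[symmetric])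
    also have "\<dots> = ?\<nu>" by (simp add: gU_eq)
    finally show ?thesis .
  qed
  moreover have "prob_space ?\<nu>" using U fU by (rule prob_space.prob_space_distr)
  ultimately have "invariant_line_measure H ?\<nu>" by (auto simp: invariant_line_measure_def)
  thus ?thesis by blast
qed

lemma measurable_span_plus:
  fixes e :: "real^'n"
  assumes e: "norm e = 1"
  shows "(\<lambda>l. span {e} + l) \<in> measurable (subspaces_borel (grassmannian ({e}\<^sup>\<bottom>) 1)) (subspaces_borel (planes_through e))"
proof (rule measurable_subspaces_borelI)
  let ?G = "grassmannian ({e}\<^sup>\<bottom>) 1"
  have e0: "e \<noteq> 0" using e by auto
  have sub: "subspace (span {e} + l)" if "subspace l" for l
    using subspace_sums[OF subspace_span[of "{e}"] that] by (simp add: set_plus_def) (smt (verit) Collect_cong)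
  have cp: "closest_point (span {e} + l) x = closest_point (span {e}) x + closest_point l x"
    if l: "l \<in> ?G" for l x
  proof (rule closest_point_subspaceI)
    have sl: "subspace l" and le: "\<And>v. v \<in> l \<Longrightarrow> e \<bullet> v = 0"
      using l by (auto simp: grassmannian_def orthogonal_comp_def orthogonal_def)
    show "subspace (span {e} + l)" using sub sl .
    note A = closest_point_subspaceE[OF sl, where x=x] and B = closest_point_subspaceE[OF subspace_span[of "{e}"], where x=x]
    show "closest_point (span {e}) x + closest_point l x \<in> span {e} + l" using A B by auto
    fix v assume "v \<in> span {e} + l"
    then obtain a w where v: "a \<in> span {e}" "w \<in> l" "v = a + w" by (auto simp: set_plus_def)
    have o: "a \<bullet> w = 0" if "a \<in> span {e}" "w \<in> l" for a w using that le by (auto simp: span_singleton)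
    show "(x - (closest_point (span {e}) x + closest_point l x)) \<bullet> v = 0"
      using A(2)[OF v(2)] B(2)[OF v(1)] o[OF v(1) A(1)] o[OF B(1) v(2)] v(3)
      by (simp add: inner_diff_left inner_diff_right inner_add_left inner_add_right inner_commute)
  qed
  let ?A = "subspaces_borel ?G"
  have "(\<lambda>l. matrix (closest_point (span {e})) + matrix (closest_point l)) \<in> borel_measurable ?A"
    by (intro borel_measurable_add measurable_matrix_closest_point) auto
  also have "?this \<longleftrightarrow> (\<lambda>l. matrix (closest_point (span {e} + l))) \<in> borel_measurable ?A"
    by (rule measurable_cong) (auto simp: matrix_def vec_eq_iff cp)
  finally show "(\<lambda>l. matrix (closest_point (span {e} + l))) \<in> borel_measurable ?A" .
  show "(\<lambda>l. span {e} + l) \<in> space ?A \<rightarrow> planes_through e"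
  proof (rule Pi_I)
    fix l assume "l \<in> space ?A"
    hence l: "l \<in> ?G" by simp
    hence sl: "subspace l" and dl: "dim l = 1" and le: "\<And>v. v \<in> l \<Longrightarrow> e \<bullet> v = 0"
      by (auto simp: grassmannian_def orthogonal_comp_def orthogonal_def)
    have int: "span {e} \<inter> l = {0}"
    proof
      show "span {e} \<inter> l \<subseteq> {0}"
      proof
        fix x assume x: "x \<in> span {e} \<inter> l"
        then obtain k where k: "x = k *\<^sub>R e" by (auto simp: span_singleton)
        with x le[of x] e0 show "x \<in> {0}" by simp
      qed
      show "{0} \<subseteq> span {e} \<inter> l" using sl by (simp add: subspace_0 span_zero)
    qed
    have sum: "span {e} + l = {x + y |x y. x \<in> span {e} \<and> y \<in> l}"
      by (auto simp: set_plus_def)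
    have "dim (span {e} + l) + dim (span {e} \<inter> l) = dim (span {e}) + dim l"
      unfolding sum by (rule dim_sums_Int[OF subspace_span sl])
    moreover have "dim (span {e}) = 1" using e0 dim_insert[of e "{}"] by simp
    ultimately have "dim (span {e} + l) = 2" using dl int by simp
    moreover have "e \<in> span {e} + l"
      using span_base[of e "{e}"] subspace_0[OF sl] by (metis add.right_neutral insertI1 set_plus_intro)
    ultimately show "span {e} + l \<in> planes_through e"
      using sub[OF sl] by (simp add: planes_through_def grassmannian_def)
  qed
qed

end

theory Submission
  imports Defs
begin

text \<open>
  Write \<open>\<pi>\<^sub>P\<close> (\<open>perp P\<close> below) for the projection to the orthogonal complement of a plane \<open>P\<close>, and
  \<open>w(v)\<close> for the component of \<open>v\<close> orthogonal to \<open>e\<close>. The measure \<open>\<mu>\<close> is disintegrated along the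
  translates of \<open>P\<close>, and the proof bounds the \<open>t\<close>-energy of the pieces, with slabs of width \<open>\<delta>\<close>
  around the translates in place of conditional measures.

  The averaged energy is finite for two reasons. By transversality (\<open>transversality\<close>), a random
  plane through \<open>e\<close> satisfies \<open>|\<pi>\<^sub>P(v)| \<le> \<delta>\<close> with probability at most a constant times
  \<open>(\<delta> / |w(v)|)\<^sup>m\<close>. The loss when \<open>v\<close> is almost parallel to \<open>e\<close> is harmless, because
  \<open>\<integral> |x - y| powr (-t) * |w(x - y)| powr (-m) d\<mu>(y)\<close> is bounded in \<open>x\<close>
  (\<open>weighted_potential_bounded\<close>): a tube of length \<open>r\<close> and radius \<open>s\<close> is covered by about \<open>r / s\<close>
  balls of radius \<open>s\<close>, so it has mass of order at most \<open>r * s powr (q - 1)\<close>, and the sum over dyadic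
  \<open>r\<close> and \<open>s\<close> converges exactly because \<open>m + 1 < q\<close> and \<open>t + m < q\<close>. Fatou's lemma
  then gives, for almost every \<open>P\<close>, a constant \<open>M\<close> such that the energy of the pairs with
  \<open>|\<pi>\<^sub>P(x - y)| \<le> 2\<delta>\<close> is at most \<open>M * \<delta>\<^sup>m\<close> for arbitrarily small \<open>\<delta>\<close> (\<open>AE_slab_energy\<close>).

  Fix such a \<open>P\<close>. The slab of width \<open>\<delta>\<close> around \<open>z + P\<close> has, on average over \<open>z\<close> in a ball, mass at
  least of order \<open>\<delta>\<^sup>m\<close> and energy at most of order \<open>\<delta>\<^sup>2\<^sup>m\<close>. Since mass squared is controlled by
  energy, the mass cannot concentrate on a small set of \<open>z\<close>: for a set of \<open>z\<close> of Lebesgue measure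
  at least \<open>l > 0\<close>, with \<open>l\<close> independent of \<open>\<delta>\<close>, the slab is ``heavy'', that is, its mass exceeds a
  multiple of its normalised energy by a multiple of \<open>\<delta>\<^sup>m\<close> (\<open>heavy_slices_positive_measure\<close>).
  A set of positive measure of points \<open>z\<close> is therefore heavy for infinitely many widths.

  Every finite cover of a heavy slab by sets of diameters \<open>\<rho>\<^sub>i\<close> has \<open>\<Sum> \<rho>\<^sub>i powr t\<close> bounded below
  independently of the width (\<open>heavy_cover_sum_ge\<close>), by the usual mass distribution argument for
  energies. By compactness of \<open>F\<close>, an open cover of the slice \<open>F \<inter> (z + P)\<close> also covers
  the part of \<open>F\<close> in all sufficiently thin slabs around it, so the lower bound passes to the slice
  (\<open>hausdorff_dim_slice_ge\<close>). The set \<open>Y\<^sub>P\<close> is the image under \<open>\<pi>\<^sub>P\<close> of the set of such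
  \<open>z\<close>; its \<open>m\<close>-dimensional Hausdorff measure is positive because slabs have Lebesgue measure
  comparable with the \<open>m\<close>-th power of their width.
\<close>

section \<open>Orthogonal projection along a subspace\<close>

definition perp :: "(real^'n) set \<Rightarrow> real^'n \<Rightarrow> real^'n" where
  "perp P x = x - closest_point P x"

lemma linear_perp: "subspace P \<Longrightarrow> linear (perp P)"
  using linear_compose_sub[OF linear_ident linear_closest_point[of P]] by (simp add: perp_def[abs_def])

lemma perp_diff: "subspace P \<Longrightarrow> perp P (x - y) = perp P x - perp P y"
  using linear_diff[OF linear_perp] .

lemma perp_in_orthogonal_comp: "subspace P \<Longrightarrow> perp P x \<in> P\<^sup>\<bottom>"
  using closest_point_subspaceE(2)[of P _ x]
  by (auto simp: perp_def orthogonal_comp_def orthogonal_def inner_commute)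

lemma perp_eq_0_iff: "subspace P \<Longrightarrow> perp P x = 0 \<longleftrightarrow> x \<in> P"
  using closest_point_subspaceE(1)[of P x] closest_point_self[of x P] by (auto simp: perp_def)

lemma perp_image:
  fixes g :: "real^'n \<Rightarrow> real^'n"
  assumes "orthogonal_transformation g" "subspace P"
  shows "perp (g ` P) (g x) = g (perp P x)"
  using closest_point_image[OF assms] linear_diff[OF orthogonal_transformation_linear[OF assms(1)]]
  by (simp add: perp_def)

lemma norm_split_perp:
  assumes "subspace P"
  shows "(norm x)\<^sup>2 = (norm (closest_point P x))\<^sup>2 + (norm (perp P x))\<^sup>2"
proof -
  have "orthogonal (closest_point P x) (perp P x)"
    using perp_in_orthogonal_comp[OF assms, of x] closest_point_subspaceE(1)[OF assms, of x]
    by (auto simp: orthogonal_comp_def)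
  from norm_add_Pythagorean[OF this] show ?thesis by (simp add: perp_def)
qed

lemma norm_perp_le:
  assumes "subspace P"
  shows "norm (perp P x) \<le> norm x"
proof -
  have "(norm (perp P x))\<^sup>2 \<le> (norm x)\<^sup>2" using norm_split_perp[OF assms, of x] by simp
  thus ?thesis by (rule power2_le_imp_le) simp
qed

lemma continuous_on_perp [continuous_intros]:
  assumes "subspace P" "continuous_on S f"
  shows "continuous_on S (\<lambda>x. perp P (f x))"
  using continuous_on_compose2[OF linear_continuous_on assms(2), of "perp P" UNIV]
    linear_perp[OF assms(1)] by (simp add: linear_linear)

lemma borel_measurable_perp [measurable (raw)]:
  assumes "subspace P" "f \<in> borel_measurable M"
  shows "(\<lambda>x. perp P (f x)) \<in> borel_measurable M"
  using measurable_compose[OF assms(2) borel_measurable_continuous_onI[OF continuous_on_perp[OF assms(1) continuous_on_id]]]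
  by simp

lemma dim_orthogonal_comp:
  fixes S :: "(real^'n) set"
  assumes "subspace S"
  shows "dim (S\<^sup>\<bottom>) + dim S = CARD('n)"
  using dim_subspace_orthogonal_to_vectors[OF assms subspace_UNIV]
  by (simp add: orthogonal_comp_def)

text \<open>
  The two isometries \<open>S \<rightarrow> T\<close> and \<open>S\<^sup>\<bottom> \<rightarrow> T\<^sup>\<bottom>\<close> are glued along the orthogonal decomposition.
\<close>

lemma ex_orthogonal_transformation_subspace:
  fixes S T :: "(real^'n) set"
  assumes S: "subspace S" and T: "subspace T" and d: "dim S = dim T"
  obtains g where "orthogonal_transformation g" "g ` S = T"
proof -
  obtain f where f: "linear f" "f ` S = T" "\<And>x. x \<in> S \<Longrightarrow> norm (f x) = norm x"
    using isometry_subspaces[OF S T d] by metis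
  have "dim (S\<^sup>\<bottom>) = dim (T\<^sup>\<bottom>)"
    using dim_orthogonal_comp[OF S] dim_orthogonal_comp[OF T] d by simp
  then obtain h where h: "linear h" "h ` (S\<^sup>\<bottom>) = T\<^sup>\<bottom>" "\<And>x. x \<in> S\<^sup>\<bottom> \<Longrightarrow> norm (h x) = norm x"
    using isometry_subspaces[OF subspace_orthogonal_comp subspace_orthogonal_comp] by metis
  define g where "g x = f (closest_point S x) + h (perp S x)" for x
  have lin: "linear g"
    unfolding g_def using linear_closest_point[OF S] linear_perp[OF S] f(1) h(1)
    by (intro linear_compose_add) (auto intro: linear_compose[unfolded o_def])
  have "norm (g x) = norm x" for x
  proof -
    have a: "closest_point S x \<in> S" and b: "perp S x \<in> S\<^sup>\<bottom>"
      using closest_point_subspaceE(1)[OF S] perp_in_orthogonal_comp[OF S] by auto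
    hence "f (closest_point S x) \<in> T" "h (perp S x) \<in> T\<^sup>\<bottom>" using f(2) h(2) by auto
    hence "orthogonal (f (closest_point S x)) (h (perp S x))" by (auto simp: orthogonal_comp_def)
    from norm_add_Pythagorean[OF this] have "(norm (g x))\<^sup>2 = (norm x)\<^sup>2"
      using f(3)[OF a] h(3)[OF b] norm_split_perp[OF S, of x] by (simp add: g_def)
    thus ?thesis by simp
  qed
  hence "orthogonal_transformation g" using lin by (simp add: orthogonal_transformation)
  moreover have "g x = f x" if "x \<in> S" for x
    using that S closest_point_self[OF that] linear_0[OF h(1)] by (simp add: g_def perp_def)
  hence "g ` S = T" using f(2) by simp
  ultimately show ?thesis using that by blast
qed

section \<open>Lebesgue measure of slabs\<close>

lemma emeasure_lborel_cbox_cart: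
  fixes a b :: "real^'n"
  assumes "\<And>k. a $ k \<le> b $ k"
  shows "emeasure lborel (cbox a b) = ennreal (\<Prod>k\<in>UNIV. b $ k - a $ k)"
proof -
  have B: "(Basis :: (real^'n) set) = range (\<lambda>k. axis k 1)" by (auto simp: Basis_vec_def)
  have "(\<Prod>u\<in>Basis. (b - a) \<bullet> u) = (\<Prod>k\<in>UNIV. b $ k - a $ k)"
    unfolding B by (subst prod.reindex) (auto simp: inj_on_def axis_eq_axis inner_axis)
  thus ?thesis
    using assms by (auto simp: emeasure_lborel_cbox_eq B inner_axis)
qed

lemma sets_slab:
  assumes "subspace P"
  shows "{z \<in> cball 0 R. norm (perp P (z - x)) \<le> r} \<in> sets borel"
proof -
  have "continuous_on UNIV (\<lambda>z. norm (perp P (z - x)))"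
    by (intro continuous_intros assms)
  hence "closed {z. norm (perp P (z - x)) \<le> r}" by (intro closed_Collect_le) auto
  hence "closed (cball 0 R \<inter> {z. norm (perp P (z - x)) \<le> r})" by (intro closed_Int) auto
  thus ?thesis by (simp add: Int_def borel_closed)
qed

definition coordinate_plane :: "'n \<Rightarrow> 'n \<Rightarrow> (real^'n) set" where
  "coordinate_plane i j = {z. \<forall>k. k \<notin> {i, j} \<longrightarrow> z $ k = 0}"

lemma subspace_coordinate_plane: "subspace (coordinate_plane i j)"
  by (auto simp: coordinate_plane_def subspace_def)

lemma dim_coordinate_plane: "i \<noteq> j \<Longrightarrow> dim (coordinate_plane i j) = 2"
  unfolding coordinate_plane_def dim_vec_eq[symmetric] dim_substandard_cart by simp

lemma perp_coordinate_plane_nth: "perp (coordinate_plane i j) x $ k = (if k \<in> {i, j} then 0 else x $ k)"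
proof -
  have "closest_point (coordinate_plane i j) x = (\<chi> k. if k \<in> {i, j} then x $ k else 0)"
    by (rule closest_point_subspaceI[OF subspace_coordinate_plane])
      (auto simp: coordinate_plane_def inner_vec_def intro!: sum.neutral)
  thus ?thesis by (auto simp: perp_def)
qed

text \<open>
  By rotation invariance of Lebesgue measure, estimates for slabs around an arbitrary plane reduce
  to those around a coordinate plane, where boxes are available.
\<close>

lemma emeasure_lborel_slab_coordinates:
  fixes P :: "(real^'n) set" and i j :: 'n
  assumes P: "subspace P" "dim P = 2" and ij: "i \<noteq> j"
  shows "\<exists>x'. norm x' = norm x \<and>
    (\<forall>R r. emeasure lborel {z \<in> cball 0 R. norm (perp P (z - x)) \<le> r} =
      emeasure lborel {z \<in> cball 0 R. norm (perp (coordinate_plane i j) (z - x')) \<le> r})"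
proof -
  let ?Q = "coordinate_plane i j"
  have "dim P = dim ?Q" using P dim_coordinate_plane[OF ij] by simp
  then obtain g where g: "orthogonal_transformation g" "g ` P = ?Q"
    using ex_orthogonal_transformation_subspace[OF P(1) subspace_coordinate_plane] by blast
  have lin: "linear g" using g orthogonal_transformation_linear by blast
  have gm: "g \<in> borel_measurable borel"
    using lin linear_continuous_on linear_linear borel_measurable_continuous_onI by blast
  show ?thesis
  proof (intro exI conjI allI)
    show "norm (g x) = norm x" using g by (simp add: orthogonal_transformation)
    fix R r
    let ?A = "{z \<in> cball 0 R. norm (perp (coordinate_plane i j) (z - g x)) \<le> r}"
    have eq: "norm (perp (coordinate_plane i j) (g z - g x)) = norm (perp P (z - x))" for z
    proof -
      have "perp (coordinate_plane i j) (g z - g x) = perp (g ` P) (g (z - x))"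
        using lin by (simp add: linear_diff g(2))
      also have "\<dots> = g (perp P (z - x))" using perp_image[OF g(1) P(1)] .
      finally show ?thesis using g(1) by (simp add: orthogonal_transformation)
    qed
    have A: "?A \<in> sets borel" by (rule sets_slab[OF subspace_coordinate_plane])
    have "emeasure lborel ?A = emeasure (distr lborel borel g) ?A"
      by (simp add: distr_lborel_orthogonal[OF g(1)])
    also have "\<dots> = emeasure lborel (g -` ?A)" using gm A by (subst emeasure_distr) auto
    also have "g -` ?A = {z \<in> cball 0 R. norm (perp P (z - x)) \<le> r}"
      using g(1) by (auto simp: eq orthogonal_transformation)
    finally show "emeasure lborel {z \<in> cball 0 R. norm (perp P (z - x)) \<le> r} = emeasure lborel ?A" ..
  qed
qed

lemma prod_two_directions:
  fixes i j :: "'n::finite" and a b :: real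
  assumes "i \<noteq> j"
  shows "(\<Prod>k\<in>UNIV. if k \<in> {i, j} then a else b) = a\<^sup>2 * b ^ (CARD('n) - 2)"
proof -
  have "card (- {i, j}) = CARD('n) - 2" using assms by (simp add: Compl_eq_Diff_UNIV card_Diff_subset)
  moreover have "card {i, j} = 2" using assms by simp
  moreover have "(\<Prod>k\<in>UNIV. if k \<in> {i, j} then a else b) = (\<Prod>k\<in>{i, j}. a) * (\<Prod>k\<in>-{i, j}. b)"
    by (subst prod.If_cases) (simp_all only: finite Collect_mem_eq Int_UNIV_left)
  ultimately show ?thesis by (simp only: prod_constant)
qed

lemma ex_two_directions:
  fixes P :: "(real^'n) set"
  assumes "dim P = 2"
  obtains i j :: 'n where "i \<noteq> j"
proof -
  have "2 \<le> CARD('n)" using dim_subset_UNIV_cart[of P] assms by simp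
  then obtain S :: "'n set" where "card S = 2" using obtain_subset_with_card_n[of 2 UNIV] by metis
  then obtain i j :: 'n where "i \<noteq> j" by (metis card_2_iff)
  thus ?thesis using that by blast
qed

text \<open>
  In coordinates adapted to \<open>P\<close>, the set lies in a box with two sides of length \<open>2 * R\<close> and all
  others of length \<open>2 * r\<close>. The bound depends neither on \<open>P\<close> nor on \<open>x\<close>, which is what averaging over \<open>P\<close> requires.
\<close>

lemma emeasure_lborel_slab_le:
  fixes P :: "(real^'n) set"
  assumes P: "subspace P" "dim P = 2" and R: "R \<ge> 0" and r: "r \<ge> 0"
  shows "emeasure lborel {z \<in> cball 0 R. norm (perp P (z - x)) \<le> r}
    \<le> ennreal ((2*R)\<^sup>2 * (2*r) ^ (CARD('n) - 2))"
proof -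
  obtain i j :: 'n where ij: "i \<noteq> j" using ex_two_directions[OF P(2)] by blast
  obtain x' where
    x': "\<forall>R r. emeasure lborel {z \<in> cball 0 R. norm (perp P (z - x)) \<le> r} =
      emeasure lborel {z \<in> cball 0 R. norm (perp (coordinate_plane i j) (z - x')) \<le> r}"
    using emeasure_lborel_slab_coordinates[OF P ij, of x] by blast
  define a where "a = (\<chi> k. if k \<in> {i, j} then - R else x' $ k - r)"
  define b where "b = (\<chi> k. if k \<in> {i, j} then R else x' $ k + r)"
  have "{z \<in> cball 0 R. norm (perp (coordinate_plane i j) (z - x')) \<le> r} \<subseteq> cbox a b"
  proof
    fix z assume z: "z \<in> {z \<in> cball 0 R. norm (perp (coordinate_plane i j) (z - x')) \<le> r}"
    have "a $ k \<le> z $ k \<and> z $ k \<le> b $ k" for k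
    proof (cases "k \<in> {i, j}")
      case True
      have "\<bar>z $ k\<bar> \<le> R" using z component_le_norm_cart[of z k] by simp
      thus ?thesis using True by (auto simp: a_def b_def)
    next
      case False
      have "\<bar>perp (coordinate_plane i j) (z - x') $ k\<bar> \<le> r" using z component_le_norm_cart[of "perp (coordinate_plane i j) (z - x')" k] by simp
      thus ?thesis using False by (auto simp: a_def b_def perp_coordinate_plane_nth)
    qed
    thus "z \<in> cbox a b" by (simp add: mem_box_cart)
  qed
  hence "emeasure lborel {z \<in> cball 0 R. norm (perp (coordinate_plane i j) (z - x')) \<le> r} \<le> emeasure lborel (cbox a b)"
    by (rule emeasure_mono) simp
  also have "\<dots> = ennreal (\<Prod>k\<in>UNIV. b $ k - a $ k)"
    by (rule emeasure_lborel_cbox_cart) (use R r in \<open>auto simp: a_def b_def\<close>)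
  also have "(\<Prod>k\<in>UNIV. b $ k - a $ k) = (\<Prod>k\<in>UNIV. if k \<in> {i, j} then 2 * R else 2 * r)"
    by (rule prod.cong) (auto simp: a_def b_def)
  finally show ?thesis by (simp only: x'[rule_format] prod_two_directions[OF ij])
qed

text \<open>
  The enlarged radius \<open>R + 1\<close> leaves room for a box around \<open>x\<close> of unit size along \<open>P\<close>. Its side
  lengths are divided by \<open>CARD('n)\<close> so that the norm can be bounded by the sum of the coordinates.
\<close>

lemma emeasure_lborel_slab_ge:
  fixes P :: "(real^'n) set"
  assumes P: "subspace P" "dim P = 2" and r: "0 < r" "r \<le> 1" and x: "norm x \<le> R"
  shows "ennreal ((2 / CARD('n))\<^sup>2 * (2 * (r / CARD('n))) ^ (CARD('n) - 2))
    \<le> emeasure lborel {z \<in> cball 0 (R + 1). norm (perp P (z - x)) \<le> r}"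
proof -
  obtain i j :: 'n where ij: "i \<noteq> j" using ex_two_directions[OF P(2)] by blast
  obtain x' where nx: "norm x' = norm x" and
    x': "\<forall>R r. emeasure lborel {z \<in> cball 0 R. norm (perp P (z - x)) \<le> r} =
      emeasure lborel {z \<in> cball 0 R. norm (perp (coordinate_plane i j) (z - x')) \<le> r}"
    using emeasure_lborel_slab_coordinates[OF P ij, of x] by blast
  let ?n = "real CARD('n)"
  define s where "s k = (if k \<in> {i, j} then 1 / ?n else r / ?n)" for k
  have sn: "0 \<le> s k" "s k \<le> 1 / ?n" for k
    using r divide_right_mono[of r 1 ?n] by (auto simp: s_def)
  define a where "a = (\<chi> k. x' $ k - s k)"
  define b where "b = (\<chi> k. x' $ k + s k)"
  have "cbox a b \<subseteq> {z \<in> cball 0 (R + 1). norm (perp (coordinate_plane i j) (z - x')) \<le> r}"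
  proof
    fix z assume "z \<in> cbox a b"
    hence "x' $ k - s k \<le> z $ k \<and> z $ k \<le> x' $ k + s k" for k
      by (simp add: mem_box_cart a_def b_def)
    hence z: "\<bar>(z - x') $ k\<bar> \<le> s k" for k
      unfolding vector_minus_component by (metis abs_diff_le_iff)
    have "norm (z - x') \<le> (\<Sum>k\<in>UNIV. \<bar>(z - x') $ k\<bar>)" by (rule norm_le_l1_cart)
    also have "\<dots> \<le> (\<Sum>k\<in>(UNIV::'n set). 1 / ?n)"
    proof (rule sum_mono)
      fix k :: 'n
      show "\<bar>(z - x') $ k\<bar> \<le> 1 / ?n" using z[of k] sn(2)[of k] by linarith
    qed
    finally have "norm (z - x') \<le> 1" by simp
    moreover have "norm z \<le> norm (z - x') + norm x'" by (metis diff_add_cancel norm_triangle_ineq)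
    ultimately have 1: "norm z \<le> R + 1" using x nx by linarith
    have "norm (perp (coordinate_plane i j) (z - x')) \<le> (\<Sum>k\<in>UNIV. \<bar>perp (coordinate_plane i j) (z - x') $ k\<bar>)" by (rule norm_le_l1_cart)
    also have "\<dots> \<le> (\<Sum>k\<in>(UNIV::'n set). r / ?n)"
    proof (rule sum_mono)
      fix k :: 'n
      show "\<bar>perp (coordinate_plane i j) (z - x') $ k\<bar> \<le> r / ?n"
        using z[of k] r by (cases "k \<in> {i, j}") (auto simp: perp_coordinate_plane_nth s_def)
    qed
    finally have "norm (perp (coordinate_plane i j) (z - x')) \<le> r" by simp
    with 1 show "z \<in> {z \<in> cball 0 (R + 1). norm (perp (coordinate_plane i j) (z - x')) \<le> r}" by simp
  qed
  moreover have "{z \<in> cball 0 (R + 1). norm (perp (coordinate_plane i j) (z - x')) \<le> r} \<in> sets lborel"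
    unfolding sets_lborel by (rule sets_slab[OF subspace_coordinate_plane])
  ultimately have "emeasure lborel (cbox a b) \<le> emeasure lborel {z \<in> cball 0 (R + 1). norm (perp (coordinate_plane i j) (z - x')) \<le> r}"
    by (rule emeasure_mono)
  moreover have "emeasure lborel (cbox a b) = ennreal (\<Prod>k\<in>UNIV. b $ k - a $ k)"
    by (rule emeasure_lborel_cbox_cart) (use sn(1) in \<open>simp add: a_def b_def add_increasing2\<close>)
  moreover have "(\<Prod>k\<in>UNIV. b $ k - a $ k) = (\<Prod>k\<in>UNIV. if k \<in> {i, j} then 2 / ?n else 2 * (r / ?n))"
    by (rule prod.cong) (auto simp: a_def b_def s_def)
  ultimately show ?thesis by (simp only: x'[rule_format] prod_two_directions[OF ij])
qed

section \<open>Transversality of the projections along random planes\<close>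

text \<open>
  The reflection in the hyperplane orthogonal to \<open>w - w'\<close>. When \<open>w = w'\<close> the quotient in the formula
  is \<open>0 / 0 = 0\<close>, and the formula gives the identity.
\<close>

lemma ex_reflection_fixing:
  fixes e w w' :: "real^'n"
  assumes n: "norm w = norm w'" and e: "e \<bullet> w = 0" "e \<bullet> w' = 0"
  obtains g where "orthogonal_transformation g" "g e = e" "g w = w'"
proof -
  define u where "u = w - w'"
  define g where "g v = v - (2 * (v \<bullet> u) / (u \<bullet> u)) *\<^sub>R u" for v
  have lin: "linear g"
    by (rule linearI) (auto simp: g_def algebra_simps inner_add_left add_divide_distrib)
  have "g v \<bullet> g v' = v \<bullet> v'" for v v'
    by (cases "u = 0") (simp_all add: g_def inner_diff_left inner_diff_right inner_commute)
  hence "orthogonal_transformation g" using lin by (simp add: orthogonal_transformation_def)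
  moreover have "g e = e" using e by (simp add: g_def u_def inner_diff_right)
  moreover have "g w = w'"
  proof (cases "u = 0")
    case False
    have "w \<bullet> w = w' \<bullet> w'" using n by (simp add: dot_square_norm)
    hence "u \<bullet> u = 2 * (w \<bullet> u)"
      by (simp add: u_def inner_diff_left inner_diff_right inner_commute)
    moreover have "u \<bullet> u \<noteq> 0" using False by simp
    ultimately have "2 * (w \<bullet> u) / (u \<bullet> u) = 1" by (metis div_self)
    hence "g w = w - u" by (simp only: g_def scaleR_one)
    thus ?thesis by (simp add: u_def)
  qed (simp add: g_def u_def)
  ultimately show ?thesis using that by blast
qed

lemma borel_measurable_perp_joint:
  assumes S: "\<And>P. P \<in> S \<Longrightarrow> subspace P"
  shows "(\<lambda>(P, v). perp P v) \<in> borel_measurable (subspaces_borel S \<Otimes>\<^sub>M borel)"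
proof -
  have "continuous_on UNIV (\<lambda>p::(real^'n^'n) \<times> (real^'n). fst p *v snd p)"
    unfolding matrix_vector_mult_def by (intro continuous_intros)
  hence c: "(\<lambda>p::(real^'n^'n) \<times> (real^'n). fst p *v snd p) \<in> borel_measurable (borel \<Otimes>\<^sub>M borel)"
    unfolding borel_prod by (rule borel_measurable_continuous_onI)
  have m: "(\<lambda>p. (matrix (closest_point (fst p)), snd p)) \<in>
      measurable (subspaces_borel S \<Otimes>\<^sub>M borel) (borel \<Otimes>\<^sub>M borel)"
    using measurable_compose[OF measurable_fst measurable_matrix_closest_point[of S]]
    by (intro measurable_Pair) auto
  have "(\<lambda>p. snd p - matrix (closest_point (fst p)) *v snd p) \<in>
      borel_measurable (subspaces_borel S \<Otimes>\<^sub>M borel)"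
    using measurable_compose[OF m c] by (intro borel_measurable_diff) auto
  also have "?this \<longleftrightarrow> ?thesis"
    by (rule measurable_cong)
      (auto simp: perp_def space_pair_measure fun_cong[OF matrix_vector_mul(2)[OF linear_closest_point[OF S]], symmetric])
  finally show ?thesis .
qed

lemma planes_throughD:
  assumes "P \<in> planes_through e"
  shows "subspace P" "dim P = 2" "e \<in> P"
  using assms by (auto simp: planes_through_def grassmannian_def)

lemma perp_perp_line:
  assumes "subspace P" "e \<in> P"
  shows "perp P (perp (span {e}) v) = perp P v"
proof -
  have "closest_point (span {e}) v \<in> P"
    using closest_point_subspaceE(1)[OF subspace_span[of "{e}"]] assms span_minimal[of "{e}" P] by blast
  hence "perp P (closest_point (span {e}) v) = 0" using assms perp_eq_0_iff by blast
  thus ?thesis using perp_diff[OF assms(1), of v "closest_point (span {e}) v"] by (simp add: perp_def[of "span {e}"])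
qed

lemma inner_perp_line: "e \<bullet> perp (span {e}) v = 0"
  using perp_in_orthogonal_comp[OF subspace_span, of "{e}" v] span_base[of e "{e}"]
  by (auto simp: orthogonal_comp_def orthogonal_def)

text \<open>
  The ratio of the upper bound \<open>4 * (2 * \<rho>) ^ m\<close> for the measure of a slab of width \<open>\<rho>\<close> in the unit
  ball to the volume of the unit ball, at \<open>\<rho> = 1\<close>.
\<close>

definition transversality_const :: "'n::finite itself \<Rightarrow> real" where
  "transversality_const _ = 4 * 2 ^ (CARD('n) - 2) / measure lborel (cball (0::real^'n) 1)"

context
  fixes e :: "real^'n" and \<nu> :: "(real^'n) set measure"
  assumes e: "norm e = 1" and \<nu>: "invariant_line_measure ({e}\<^sup>\<bottom>) \<nu>"
begin

abbreviation (input) "\<gamma> \<equiv> planes_through_measure e \<nu>"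

lemma sets_planes_through_measure: "sets \<gamma> = sets (subspaces_borel (planes_through e))"
  and space_planes_through_measure: "space \<gamma> = planes_through e"
  by (simp_all add: planes_through_measure_def)

lemma measurable_span_plus_\<nu>:
  "(\<lambda>l. span {e} + l) \<in> measurable \<nu> (subspaces_borel (planes_through e))"
  using measurable_span_plus[OF e] \<nu>
  by (simp add: invariant_line_measure_def measurable_cong_sets[of \<nu> "subspaces_borel (grassmannian ({e}\<^sup>\<bottom>) 1)"])

lemma prob_space_planes_through_measure: "prob_space \<gamma>"
  unfolding planes_through_measure_def using \<nu> measurable_span_plus_\<nu>
  by (intro prob_space.prob_space_distr) (auto simp: invariant_line_measure_def)

lemma borel_measurable_perp_planes [measurable]:
  "(\<lambda>(P, v). perp P v) \<in> borel_measurable (\<gamma> \<Otimes>\<^sub>M borel)"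
  using borel_measurable_perp_joint[OF planes_throughD(1)[where e=e]]
  by (simp add: measurable_cong_sets[OF sets_pair_measure_cong[OF sets_planes_through_measure refl] refl])

lemma borel_measurable_perp_fst [measurable]:
  "(\<lambda>P. perp P v) \<in> borel_measurable \<gamma>"
  using measurable_compose[OF measurable_Pair[OF measurable_id measurable_const] borel_measurable_perp_planes, of v]
  by (simp add: id_def)

text \<open>
  Orthogonal maps fixing \<open>e\<close> preserve the distribution of the plane, and \<open>perp (g ` P) (g v) = g (perp P v)\<close>.
\<close>

lemma emeasure_planes_near_invariant:
  assumes g: "orthogonal_transformation g" "g e = e"
  shows "emeasure \<gamma> {P \<in> space \<gamma>. norm (perp P (g v)) \<le> r} =
         emeasure \<gamma> {P \<in> space \<gamma>. norm (perp P v) \<le> r}"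
proof -
  have lin: "linear g" using g orthogonal_transformation_linear by blast
  have iso: "g x \<bullet> g y = x \<bullet> y" for x y using g by (simp add: orthogonal_transformation_def)
  have "g ` ({e}\<^sup>\<bottom>) = {e}\<^sup>\<bottom>"
  proof
    show "g ` ({e}\<^sup>\<bottom>) \<subseteq> {e}\<^sup>\<bottom>"
      using iso[of e] g(2) by (auto simp: orthogonal_comp_def orthogonal_def)
    show "{e}\<^sup>\<bottom> \<subseteq> g ` ({e}\<^sup>\<bottom>)"
    proof
      fix y assume y: "y \<in> {e}\<^sup>\<bottom>"
      obtain x where x: "y = g x" using orthogonal_transformation_surj[OF g(1)] by (metis surjD)
      have "x \<in> {e}\<^sup>\<bottom>" using y iso[of e x] g(2) x by (auto simp: orthogonal_comp_def orthogonal_def)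
      thus "y \<in> g ` ({e}\<^sup>\<bottom>)" using x by blast
    qed
  qed
  hence gH: "g \<in> orthogonal_group ({e}\<^sup>\<bottom>)" using g by (simp add: orthogonal_group_def)
  have s\<nu>: "sets \<nu> = sets (subspaces_borel (grassmannian ({e}\<^sup>\<bottom>) 1))"
    and inv: "distr \<nu> \<nu> (\<lambda>l. g ` l) = \<nu>"
    using \<nu> gH by (auto simp: invariant_line_measure_def)
  have gm: "(\<lambda>l. g ` l) \<in> measurable \<nu> \<nu>"
    using measurable_image[OF gH, of 1] by (simp add: measurable_cong_sets[OF s\<nu> s\<nu>])
  have sp\<nu>: "space \<nu> = grassmannian ({e}\<^sup>\<bottom>) 1" using sets_eq_imp_space_eq[OF s\<nu>] by simp
  let ?T = "\<lambda>l. span {e} + l"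
  let ?B = "\<lambda>v. {P \<in> space \<gamma>. norm (perp P v) \<le> r}"
  have B: "?B v \<in> sets (subspaces_borel (planes_through e))" for v
  proof -
    have "?B v \<in> sets \<gamma>" by measurable
    thus ?thesis by (simp add: sets_planes_through_measure)
  qed
  have gT: "?T (g ` l) = g ` ?T l" for l
  proof -
    have "g ` span {e} = span {e}" using linear_span_image[OF lin, of "{e}"] g(2) by simp
    moreover have "g ` (span {e} + l) = g ` span {e} + g ` l"
      using linear_add[OF lin] by (auto simp: set_plus_def image_iff) metis+
    ultimately show ?thesis by simp
  qed
  have T: "?T l \<in> planes_through e" if "l \<in> space \<nu>" for l
    using measurable_space[OF measurable_span_plus_\<nu> that] by simp
  have gl: "g ` l \<in> space \<nu>" if "l \<in> space \<nu>" for l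
    using measurable_space[OF gm that] .
  have E: "emeasure \<gamma> (?B v) = emeasure \<nu> (?T -` ?B v \<inter> space \<nu>)" for v
    unfolding planes_through_measure_def
    by (rule emeasure_distr[OF measurable_span_plus_\<nu>]) (use B in \<open>simp add: planes_through_measure_def\<close>)
  have TB: "?T -` ?B v \<inter> space \<nu> \<in> sets \<nu>" for v
    using measurable_sets[OF measurable_span_plus_\<nu> B] .
  have "emeasure \<nu> (?T -` ?B (g v) \<inter> space \<nu>) = emeasure (distr \<nu> \<nu> (\<lambda>l. g ` l)) (?T -` ?B (g v) \<inter> space \<nu>)"
    by (simp add: inv)
  also have "\<dots> = emeasure \<nu> ((\<lambda>l. g ` l) -` (?T -` ?B (g v) \<inter> space \<nu>) \<inter> space \<nu>)"
    by (rule emeasure_distr[OF gm TB])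
  also have "(\<lambda>l. g ` l) -` (?T -` ?B (g v) \<inter> space \<nu>) \<inter> space \<nu> = ?T -` ?B v \<inter> space \<nu>"
  proof -
    have "norm (perp (?T (g ` l)) (g v)) = norm (perp (?T l) v)" if "l \<in> space \<nu>" for l
      using perp_image[OF g(1) planes_throughD(1)[OF T[OF that]], of v] g(1)
      unfolding gT by (simp add: orthogonal_transformation)
    thus ?thesis using T gl by (auto simp: space_planes_through_measure)
  qed
  finally show ?thesis by (simp only: E)
qed

text \<open>
  After scaling, some reflection fixing \<open>e\<close> takes the component of \<open>z\<close> orthogonal to \<open>e\<close> to that of
  \<open>v\<close>, so both sides agree unless \<open>z\<close> lies on the line through \<open>e\<close>; in that case the right-hand
  side is \<open>1\<close>. The inequality, in contrast to the equality, holds for all \<open>z\<close> and can be integrated.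
\<close>

lemma emeasure_planes_near_mono:
  fixes v z :: "real^'n"
  assumes \<rho>: "\<rho> \<ge> 0" and v: "perp (span {e}) v \<noteq> 0"
  shows "emeasure \<gamma> {P \<in> space \<gamma>. norm (perp P v) \<le> \<rho> * norm (perp (span {e}) v)}
     \<le> emeasure \<gamma> {P \<in> space \<gamma>. norm (perp P z) \<le> \<rho> * norm (perp (span {e}) z)}"
proof -
  let ?w = "perp (span {e})"
  interpret prob_space \<gamma> by (rule prob_space_planes_through_measure)
  have pw: "perp P (?w v) = perp P v" if "P \<in> space \<gamma>" for P v
    using that perp_perp_line[OF planes_throughD(1,3)[of P e]] by (simp add: space_planes_through_measure)
  show ?thesis
  proof (cases "?w z = 0")
    case True
    have "perp P z = 0" if "P \<in> space \<gamma>" for P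
    proof -
      have "subspace P" using planes_throughD(1) that space_planes_through_measure by blast
      thus ?thesis using pw[OF that, of z] True linear_0[OF linear_perp] by metis
    qed
    hence "{P \<in> space \<gamma>. norm (perp P z) \<le> \<rho> * norm (?w z)} = space \<gamma>"
      using \<rho> by auto
    thus ?thesis by (simp add: emeasure_space_1 emeasure_le_1)
  next
    case False
    define c where "c = norm (?w v) / norm (?w z)"
    have c: "c > 0" using v False by (simp add: c_def)
    have "norm (c *\<^sub>R ?w z) = norm (?w v)" using False by (simp add: c_def)
    then obtain g where g: "orthogonal_transformation g" "g e = e" "g (c *\<^sub>R ?w z) = ?w v"
      using ex_reflection_fixing[of "c *\<^sub>R ?w z" "?w v" e] by (auto simp: inner_perp_line)
    have eq: "norm (perp P (c *\<^sub>R ?w z)) \<le> \<rho> * norm (?w v) \<longleftrightarrow> norm (perp P z) \<le> \<rho> * norm (?w z)"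
      if "P \<in> space \<gamma>" for P
    proof -
      have "subspace P" using planes_throughD(1) that space_planes_through_measure by blast
      hence "norm (perp P (c *\<^sub>R ?w z)) = c * norm (perp P z)"
        using pw[OF that, of z] c by (simp add: linear_scale[OF linear_perp])
      moreover have "norm (?w v) = c * norm (?w z)" using False by (simp add: c_def)
      ultimately show ?thesis using c by (simp add: mult.left_commute)
    qed
    have "{P \<in> space \<gamma>. norm (perp P v) \<le> \<rho> * norm (?w v)} =
        {P \<in> space \<gamma>. norm (perp P (g (c *\<^sub>R ?w z))) \<le> \<rho> * norm (?w v)}"
      unfolding g(3) using pw by auto
    hence "emeasure \<gamma> {P \<in> space \<gamma>. norm (perp P v) \<le> \<rho> * norm (?w v)} =
        emeasure \<gamma> {P \<in> space \<gamma>. norm (perp P (c *\<^sub>R ?w z)) \<le> \<rho> * norm (?w v)}"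
      by (simp only: emeasure_planes_near_invariant[OF g(1,2)])
    also have "{P \<in> space \<gamma>. norm (perp P (c *\<^sub>R ?w z)) \<le> \<rho> * norm (?w v)} =
        {P \<in> space \<gamma>. norm (perp P z) \<le> \<rho> * norm (?w z)}"
      using eq by blast
    finally show ?thesis by simp
  qed
qed

text \<open>
  The probability depends only on the ratio \<open>\<rho>\<close> of \<open>r\<close> and the distance of \<open>v\<close> from the line
  through \<open>e\<close>, so \<open>v\<close> may be replaced by an average over \<open>z\<close> in the unit ball. Exchanging the
  integrals turns the average into the volume of the slab of width \<open>\<rho>\<close> around a fixed plane.
\<close>

lemma transversality:
  fixes v :: "real^'n"
  assumes r: "r \<ge> 0" and v: "perp (span {e}) v \<noteq> 0"
  shows "emeasure \<gamma> {P \<in> space \<gamma>. norm (perp P v) \<le> r}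
     \<le> ennreal (transversality_const TYPE('n) * (r / norm (perp (span {e}) v)) ^ (CARD('n) - 2))"
proof -
  let ?w = "perp (span {e})" and ?m = "CARD('n) - 2"
  let ?D = "cball (0::real^'n) 1"
  define \<rho> where "\<rho> = r / norm (?w v)"
  have \<rho>: "\<rho> \<ge> 0" "r = \<rho> * norm (?w v)" using r v by (auto simp: \<rho>_def)
  interpret G: prob_space \<gamma> by (rule prob_space_planes_through_measure)
  interpret pair_sigma_finite \<gamma> "lborel :: (real^'n) measure" ..
  define A where "A = emeasure \<gamma> {P \<in> space \<gamma>. norm (perp P v) \<le> r}"
  define f :: "(real^'n) set \<Rightarrow> real^'n \<Rightarrow> ennreal" where
    "f P z = indicator {z. norm z \<le> 1 \<and> norm (perp P z) \<le> \<rho>} z" for P z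
  have fm: "case_prod f \<in> borel_measurable (\<gamma> \<Otimes>\<^sub>M lborel)"
  proof -
    have [measurable]: "(\<lambda>(P, v). perp P v) \<in> borel_measurable (\<gamma> \<Otimes>\<^sub>M lborel)"
      using borel_measurable_perp_planes
      by (simp add: measurable_cong_sets[OF sets_pair_measure_cong[OF refl sets_lborel] refl])
    have "(\<lambda>p. if norm (snd p) \<le> 1 \<and> norm ((\<lambda>(P, v). perp P v) p) \<le> \<rho> then 1 else 0 :: ennreal)
      \<in> borel_measurable (\<gamma> \<Otimes>\<^sub>M lborel)"
      by measurable
    also have "(\<lambda>p. if norm (snd p) \<le> 1 \<and> norm ((\<lambda>(P, v). perp P v) p) \<le> \<rho> then 1 else 0 :: ennreal) = case_prod f"
      by (auto simp: f_def fun_eq_iff)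
    finally show ?thesis .
  qed
  have "A * emeasure lborel ?D = (\<integral>\<^sup>+z. A * indicator ?D z \<partial>lborel)"
    by (simp add: nn_integral_cmult_indicator)
  also have "\<dots> \<le> (\<integral>\<^sup>+z. (\<integral>\<^sup>+P. f P z \<partial>\<gamma>) \<partial>lborel)"
  proof (rule nn_integral_mono)
    fix z :: "real^'n"
    show "A * indicator ?D z \<le> (\<integral>\<^sup>+P. f P z \<partial>\<gamma>)"
    proof (cases "z \<in> ?D")
      case True
      hence z: "norm z \<le> 1" by simp
      have "norm (?w z) \<le> 1" using norm_perp_le[OF subspace_span, of "{e}" z] z by linarith
      hence "\<rho> * norm (?w z) \<le> \<rho>" using \<rho>(1) mult_left_mono[of "norm (?w z)" 1 \<rho>] by simp
      hence "A \<le> emeasure \<gamma> {P \<in> space \<gamma>. norm (perp P z) \<le> \<rho>}"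
        unfolding A_def \<rho>(2)
        by (intro order.trans[OF emeasure_planes_near_mono[OF \<rho>(1) v, of z]] emeasure_mono) auto
      also have "\<dots> = (\<integral>\<^sup>+P. indicator {P \<in> space \<gamma>. norm (perp P z) \<le> \<rho>} P \<partial>\<gamma>)" by simp
      also have "\<dots> = (\<integral>\<^sup>+P. f P z \<partial>\<gamma>)"
        using z by (intro nn_integral_cong) (auto simp: f_def indicator_def)
      finally show ?thesis using True by simp
    qed simp
  qed
  also have "\<dots> = (\<integral>\<^sup>+P. (\<integral>\<^sup>+z. f P z \<partial>lborel) \<partial>\<gamma>)"
    by (rule Fubini'[OF fm])
  also have "\<dots> \<le> (\<integral>\<^sup>+P. ennreal (4 * (2 * \<rho>) ^ ?m) \<partial>\<gamma>)"
  proof (rule nn_integral_mono)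
    fix P assume "P \<in> space \<gamma>"
    hence P: "subspace P" "dim P = 2" using planes_throughD by (auto simp: space_planes_through_measure)
    have "(\<integral>\<^sup>+z. f P z \<partial>lborel) = emeasure lborel {z \<in> cball 0 1. norm (perp P (z - 0)) \<le> \<rho>}"
      using sets_slab[OF P(1), of 1 0 \<rho>] by (simp add: f_def)
    also have "\<dots> \<le> ennreal ((2*1)\<^sup>2 * (2 * \<rho>) ^ ?m)"
      by (rule emeasure_lborel_slab_le[OF P]) (use \<rho> in auto)
    finally show "(\<integral>\<^sup>+z. f P z \<partial>lborel) \<le> ennreal (4 * (2 * \<rho>) ^ ?m)" by simp
  qed
  also have "\<dots> = ennreal (4 * (2 * \<rho>) ^ ?m)" by (simp add: G.emeasure_space_1)
  finally have le: "A * emeasure lborel ?D \<le> ennreal (4 * (2 * \<rho>) ^ ?m)" .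
  have D: "emeasure lborel ?D = ennreal (measure lborel ?D)"
    by (rule emeasure_eq_ennreal_measure) (use emeasure_lborel_cball_finite[of "0::real^'n" 1] in auto)
  have Dpos: "measure lborel ?D > 0" using content_cball_pos[of 1 "0::real^'n"] by simp
  have "A = A * emeasure lborel ?D / emeasure lborel ?D"
    using Dpos by (intro ennreal_mult_divide_eq[symmetric]) (simp_all add: D)
  also have "\<dots> \<le> ennreal (4 * (2 * \<rho>) ^ ?m) / emeasure lborel ?D"
    by (rule divide_right_mono_ennreal[OF le])
  also have "\<dots> = ennreal (4 * (2 * \<rho>) ^ ?m / measure lborel ?D)"
    unfolding D using \<rho>(1) Dpos by (intro divide_ennreal) auto
  also have "4 * (2 * \<rho>) ^ ?m / measure lborel ?D = transversality_const TYPE('n) * \<rho> ^ ?m"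
    by (simp add: transversality_const_def power_mult_distrib)
  finally show ?thesis by (simp add: A_def \<rho>_def)
qed

end

section \<open>Finiteness of the weighted energy\<close>

text \<open>
  The Riesz kernel \<open>|v| powr (-s)\<close>, with the value \<open>\<infinity>\<close> at the origin (whereas \<open>0 powr (-s) = 0\<close>), so
  that lower bounds for energies hold on the diagonal as well.
\<close>

definition riesz :: "real \<Rightarrow> real^'n \<Rightarrow> ennreal" where
  "riesz s v = inverse (ennreal (norm v powr s))"

lemma borel_measurable_riesz [measurable]: "riesz s \<in> borel_measurable borel"
  unfolding riesz_def[abs_def] by measurable

lemma riesz_eq: "v \<noteq> 0 \<Longrightarrow> riesz s v = ennreal (norm v powr (- s))"
  by (simp add: riesz_def inverse_ennreal powr_minus)

lemma riesz_le:
  assumes "0 < a" "a \<le> norm v" "s \<ge> 0"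
  shows "riesz s v \<le> ennreal (a powr (- s))"
proof -
  have "v \<noteq> 0" using assms by auto
  moreover have "norm v powr (- s) \<le> a powr (- s)" using assms by (intro powr_mono2') auto
  ultimately show ?thesis by (simp add: riesz_eq ennreal_leI)
qed

lemma riesz_ge:
  assumes "norm v \<le> a" "s \<ge> 0"
  shows "ennreal (a powr (- s)) \<le> riesz s v"
proof (cases "v = 0")
  case False
  moreover have "a powr (- s) \<le> norm v powr (- s)" using assms False by (intro powr_mono2') auto
  ultimately show ?thesis by (simp add: riesz_eq ennreal_leI)
qed (simp add: riesz_def)

lemma ennreal_le_suminf: "f i \<le> (\<Sum>i. f i :: ennreal)"
  using sum_le_suminf[of f "{i}"] by simp

lemma ex_dyadic_scale:
  fixes x R :: real
  assumes "0 < x" "x \<le> R"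
  obtains j :: nat where "R / 2 ^ Suc j < x" "x \<le> R / 2 ^ j"
proof -
  have "\<exists>n. R / x < 2 ^ n" by (rule real_arch_pow) simp
  hence ex: "\<exists>n. R / 2 ^ n < x" using assms by (simp add: field_simps)
  define n where "n = (LEAST n. R / 2 ^ n < x)"
  have n: "R / 2 ^ n < x" unfolding n_def using LeastI_ex[OF ex] .
  then obtain j where j: "n = Suc j" using assms by (cases n) auto
  have "\<not> R / 2 ^ j < x" using not_less_Least[of j "\<lambda>n. R / 2 ^ n < x"] j by (simp add: n_def)
  thus ?thesis using that n j by auto
qed

locale frostman =
  fixes \<mu> :: "(real^'n) measure" and C q :: real
  assumes sets_mu [measurable_cong]: "sets \<mu> = sets borel"
    and prob: "prob_space \<mu>"
    and mass_cball_le: "\<And>x r. r > 0 \<Longrightarrow> measure \<mu> (cball x r) \<le> C * r powr q"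
begin

sublocale prob_space \<mu> by (rule prob)

lemma C_nonneg: "C \<ge> 0"
proof -
  have "0 \<le> measure \<mu> (cball 0 1)" by simp
  also have "\<dots> \<le> C * 1 powr q" by (rule mass_cball_le) simp
  finally show ?thesis by simp
qed

lemma emeasure_cball_le: "r > 0 \<Longrightarrow> emeasure \<mu> (cball x r) \<le> ennreal (C * r powr q)"
  using mass_cball_le by (simp add: emeasure_eq_measure ennreal_leI)

text \<open>
  Balls of radius \<open>2 * s\<close> centred at the points \<open>x - k s e\<close> of the axis, with \<open>|k| \<le> \<lceil>r / s\<rceil>\<close>,
  cover the tube. There are at most \<open>5 * r / s\<close> of them, as \<open>s \<le> r\<close>.
\<close>

lemma emeasure_tube_le:
  fixes e :: "real^'n"
  assumes e: "norm e = 1" and s: "0 < s" "s \<le> r"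
  shows "emeasure \<mu> {y. norm (x - y) \<le> r \<and> norm (perp (span {e}) (x - y)) \<le> s}
    \<le> ennreal (5 * 2 powr q * C * r * s powr (q - 1))" (is "emeasure \<mu> ?T \<le> _")
proof -
  define N where "N = \<lceil>r / s\<rceil>"
  let ?B = "\<lambda>k. cball (x - (of_int k * s) *\<^sub>R e) (2 * s)"
  have "?T \<subseteq> (\<Union>k\<in>{-N..N}. ?B k)"
  proof
    fix y assume y: "y \<in> ?T"
    let ?v = "x - y"
    define a where "a = ?v \<bullet> e"
    define k where "k = \<lfloor>a / s\<rfloor>"
    have "e \<noteq> 0" using e by auto
    hence cp: "closest_point (span {e}) ?v = a *\<^sub>R e"
      using e by (subst closest_point_span1) (simp_all add: a_def dot_square_norm)
    have "\<bar>a\<bar> \<le> norm ?v * norm e" unfolding a_def by (rule Cauchy_Schwarz_ineq2)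
    hence a: "\<bar>a\<bar> \<le> r" using y e by simp
    hence as: "- (r / s) \<le> a / s" "a / s \<le> r / s" using s by (simp_all add: field_simps)
    have "k \<le> N" unfolding k_def N_def using as(2) by linarith
    moreover have "- N \<le> k" unfolding k_def N_def using as(1) by linarith
    moreover have "y \<in> ?B k"
    proof -
      have "of_int k \<le> a / s" "a / s < of_int k + 1" unfolding k_def by linarith+
      hence "of_int k * s \<le> a" "a \<le> of_int k * s + s" using s by (simp_all add: field_simps)
      hence "\<bar>a - of_int k * s\<bar> \<le> s" by linarith
      hence "norm ((a - of_int k * s) *\<^sub>R e) \<le> s" using e by simp
      moreover have "norm (?v - a *\<^sub>R e) \<le> s" using y cp by (simp add: perp_def)
      ultimately have "norm ((?v - a *\<^sub>R e) + (a - of_int k * s) *\<^sub>R e) \<le> 2 * s"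
        using norm_triangle_ineq[of "?v - a *\<^sub>R e" "(a - of_int k * s) *\<^sub>R e"] by linarith
      moreover have "x - (of_int k * s) *\<^sub>R e - y = (?v - a *\<^sub>R e) + (a - of_int k * s) *\<^sub>R e"
        by (simp add: algebra_simps)
      ultimately have "norm (x - (of_int k * s) *\<^sub>R e - y) \<le> 2 * s" by metis
      thus ?thesis by (simp add: dist_norm)
    qed
    ultimately show "y \<in> (\<Union>k\<in>{-N..N}. ?B k)" by auto
  qed
  hence "emeasure \<mu> ?T \<le> emeasure \<mu> (\<Union>k\<in>{-N..N}. ?B k)"
    by (intro emeasure_mono) auto
  also have "\<dots> \<le> (\<Sum>k\<in>{-N..N}. emeasure \<mu> (?B k))"
    by (intro emeasure_subadditive_finite) (auto simp: sets_mu)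
  also have "\<dots> \<le> (\<Sum>k\<in>{-N..N}. ennreal (C * (2 * s) powr q))"
    using s by (intro sum_mono emeasure_cball_le) auto
  also have "\<dots> = ennreal (real (card {-N..N}) * (C * (2 * s) powr q))"
    using C_nonneg by (simp add: ennreal_mult ennreal_of_nat_eq_real_of_nat)
  also have "\<dots> \<le> ennreal (5 * 2 powr q * C * r * s powr (q - 1))"
  proof (rule ennreal_leI)
    have rs: "1 \<le> r / s" using s by simp
    have "of_int N \<le> r / s + 1" unfolding N_def by linarith
    moreover have "N \<ge> 0" unfolding N_def using rs by linarith
    ultimately have "real (card {-N..N}) \<le> 5 * (r / s)" using rs by simp
    hence "real (card {-N..N}) * (C * (2 * s) powr q) \<le> 5 * (r / s) * (C * (2 * s) powr q)"
      using C_nonneg by (intro mult_right_mono) auto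
    also have "\<dots> = 5 * 2 powr q * C * r * s powr (q - 1)"
      using s by (simp add: powr_mult powr_diff field_simps)
    finally show "real (card {-N..N}) * (C * (2 * s) powr q) \<le> 5 * 2 powr q * C * r * s powr (q - 1)" .
  qed
  finally show ?thesis .
qed

lemma AE_off_line:
  fixes e :: "real^'n"
  assumes e: "norm e = 1" and q: "q > 1" and r: "r > 0"
  shows "AE y in \<mu>. y \<in> cball x r \<longrightarrow> perp (span {e}) (x - y) \<noteq> 0"
proof (rule AE_I)
  let ?Z = "{y. norm (x - y) \<le> r \<and> norm (perp (span {e}) (x - y)) \<le> 0}"
  let ?T = "\<lambda>s. {y. norm (x - y) \<le> r \<and> norm (perp (span {e}) (x - y)) \<le> s}"
  have [measurable]: "(\<lambda>y. perp (span {e}) (x - y)) \<in> borel_measurable \<mu>"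
    using borel_measurable_perp[OF subspace_span, of "\<lambda>y. x - y" \<mu> "{e}"] by simp
  have T: "?T s \<in> sets \<mu>" for s
  proof -
    have "{y \<in> space \<mu>. norm (x - y) \<le> r \<and> norm (perp (span {e}) (x - y)) \<le> s} \<in> sets \<mu>" by measurable
    thus ?thesis using sets_eq_imp_space_eq[OF sets_mu] by simp
  qed
  show "{y \<in> space \<mu>. \<not> (y \<in> cball x r \<longrightarrow> perp (span {e}) (x - y) \<noteq> 0)} \<subseteq> ?Z"
    by (auto simp: dist_norm)
  show "?Z \<in> sets \<mu>" by (rule T)
  have "emeasure \<mu> ?Z \<le> ennreal (5 * 2 powr q * C * r * s powr (q - 1))" if "0 < s" "s \<le> r" for s
    using that by (intro order.trans[OF emeasure_mono[of ?Z "?T s"] emeasure_tube_le[OF e]] T) auto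
  hence ev: "eventually (\<lambda>s. emeasure \<mu> ?Z \<le> ennreal (5 * 2 powr q * C * r * s powr (q - 1))) (at_right 0)"
    unfolding eventually_at_right_field using r by (intro exI[of _ r]) auto
  have "((\<lambda>s. 5 * 2 powr q * C * r * s powr (q - 1)) \<longlongrightarrow> 5 * 2 powr q * C * r * 0) (at_right 0)"
    using q by (intro tendsto_intros tendsto_powr' tendsto_ident_at) real_asymp
  hence "((\<lambda>s. ennreal (5 * 2 powr q * C * r * s powr (q - 1))) \<longlongrightarrow> ennreal 0) (at_right 0)"
    by (intro tendsto_ennrealI) simp
  from tendsto_lowerbound[OF this ev] show "emeasure \<mu> ?Z = 0" by simp
qed

text \<open>
  The vectors \<open>v = x - y\<close> are sorted by the dyadic sizes of \<open>|v|\<close> (index \<open>j\<close>) and of the quotient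
  of the distance of \<open>v\<close> from the line through \<open>e\<close> by \<open>|v|\<close> (index \<open>i\<close>). The tube estimate bounds
  the contribution of \<open>(j, i)\<close> by \<open>D * a ^ j * b ^ i\<close>; the two hypotheses on the exponents say that
  \<open>a < 1\<close> and \<open>b < 1\<close>.
\<close>

lemma weighted_potential_bounded:
  fixes e :: "real^'n"
  assumes e: "norm e = 1" and s: "0 < s" "s + 1 < q" and t: "0 < t" "t + s < q" and R: "R > 0"
  shows "\<exists>K. \<forall>x. (\<integral>\<^sup>+y. riesz t (x - y) * riesz s (perp (span {e}) (x - y)) * indicator (cball x R) y \<partial>\<mu>) \<le> ennreal K"
proof -
  let ?w = "perp (span {e})"
  define r where "r j = R / 2 ^ j" for j :: nat
  define \<sigma> where "\<sigma> j i = R / 2 ^ (j + i)" for j i :: nat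
  define c where "c j i = (r j / 2) powr (- t) * (\<sigma> j i / 2) powr (- s)" for j i
  define a where "a = 2 powr (- (q - s - t))"
  define b where "b = 2 powr (- (q - 1 - s))"
  define D where "D = 5 * 2 powr q * C * (2 powr (t + s) * R powr (q - s - t))"
  have rpos: "r j > 0" and \<sigma>pos: "\<sigma> j i > 0" and \<sigma>r: "\<sigma> j i \<le> r j" for i j
    using R by (auto simp: r_def \<sigma>_def power_add field_simps)
  have ab: "0 \<le> a" "a < 1" "0 \<le> b" "b < 1"
    using s t by (auto simp: a_def b_def powr_less_one)
  have q: "q > 1" using s by simp
  have D: "D \<ge> 0" using C_nonneg by (simp add: D_def)
  have prod: "c j i * (5 * 2 powr q * C * r j * \<sigma> j i powr (q - 1)) = D * a ^ j * b ^ i" for i j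
  proof -
    have two: "(2::real) ^ k = 2 powr real k" for k by (simp add: powr_realpow)
    have rj: "r j = R * 2 powr (- real j)" by (simp only: r_def two powr_minus divide_inverse)
    have sj: "\<sigma> j i = R * 2 powr (- real (j + i))" by (simp only: \<sigma>_def two powr_minus divide_inverse)
    have 1: "(r j / 2) powr (- t) = R powr (- t) * 2 powr ((- real j - 1) * (- t))"
    proof -
      have "r j / 2 = R * 2 powr (- real j - 1)" by (simp add: rj powr_diff)
      thus ?thesis using R by (simp add: powr_mult powr_powr)
    qed
    have 2: "(\<sigma> j i / 2) powr (- s) = R powr (- s) * 2 powr ((- real (j + i) - 1) * (- s))"
    proof -
      have "\<sigma> j i / 2 = R * 2 powr (- real (j + i) - 1)" by (simp add: sj powr_diff)
      thus ?thesis using R by (simp add: powr_mult powr_powr)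
    qed
    have 3: "\<sigma> j i powr (q - 1) = R powr (q - 1) * 2 powr (- real (j + i) * (q - 1))"
      using R by (simp add: sj powr_mult powr_powr)
    have 4: "r j = R powr 1 * 2 powr (- real j)" using R by (simp add: rj)
    have aj: "a ^ j = 2 powr (- (q - s - t) * real j)"
      unfolding a_def by (subst powr_realpow[symmetric]) (simp_all add: powr_powr)
    have bi: "b ^ i = 2 powr (- (q - 1 - s) * real i)"
      unfolding b_def by (subst powr_realpow[symmetric]) (simp_all add: powr_powr)
    have RR: "R powr (- t) * R powr (- s) * R powr 1 * R powr (q - 1) = R powr (q - s - t)"
      by (simp only: powr_add[symmetric]) (simp add: algebra_simps)
    have TT: "2 powr ((- real j - 1) * (- t)) * 2 powr ((- real (j + i) - 1) * (- s)) * 2 powr (- real j)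
        * 2 powr (- real (j + i) * (q - 1)) =
        (2::real) powr (t + s) * 2 powr (- (q - s - t) * real j) * 2 powr (- (q - 1 - s) * real i)"
      by (simp only: powr_add[symmetric]) (simp add: algebra_simps)
    have "c j i * (5 * 2 powr q * C * r j * \<sigma> j i powr (q - 1)) =
      5 * 2 powr q * C * (R powr (- t) * R powr (- s) * R powr 1 * R powr (q - 1)) *
      (2 powr ((- real j - 1) * (- t)) * 2 powr ((- real (j + i) - 1) * (- s)) * 2 powr (- real j)
        * 2 powr (- real (j + i) * (q - 1)))"
      unfolding c_def 1 2 3 by (subst 4) (simp only: mult_ac)
    also have "\<dots> = D * a ^ j * b ^ i"
      unfolding RR TT aj bi D_def by (simp only: mult_ac)
    finally show ?thesis .
  qed
  \<comment> \<open>the value of the double geometric series\<close>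
  have "(\<integral>\<^sup>+y. riesz t (x - y) * riesz s (?w (x - y)) * indicator (cball x R) y \<partial>\<mu>)
      \<le> ennreal (D / (1 - a) / (1 - b))" for x
  proof -
    let ?T = "\<lambda>j i. {y. norm (x - y) \<le> r j \<and> norm (?w (x - y)) \<le> \<sigma> j i}"
    have [measurable]: "(\<lambda>y. ?w (x - y)) \<in> borel_measurable \<mu>"
      using borel_measurable_perp[OF subspace_span, of "\<lambda>y. x - y" \<mu> "{e}"] by simp
    have T [measurable]: "?T j i \<in> sets \<mu>" for j i
    proof -
      have "{y \<in> space \<mu>. norm (x - y) \<le> r j \<and> norm (?w (x - y)) \<le> \<sigma> j i} \<in> sets \<mu>" by measurable
      thus ?thesis using sets_eq_imp_space_eq[OF sets_mu] by simp
    qed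
    have "(\<integral>\<^sup>+y. riesz t (x - y) * riesz s (?w (x - y)) * indicator (cball x R) y \<partial>\<mu>)
       \<le> (\<integral>\<^sup>+y. (\<Sum>j. \<Sum>i. ennreal (c j i) * indicator (?T j i) y) \<partial>\<mu>)"
    proof (rule nn_integral_mono_AE)
      show "AE y in \<mu>. riesz t (x - y) * riesz s (?w (x - y)) * indicator (cball x R) y
          \<le> (\<Sum>j. \<Sum>i. ennreal (c j i) * indicator (?T j i) y)"
        using AE_off_line[OF e q R, of x]
      proof eventually_elim
        case (elim y)
        show ?case
        proof (cases "y \<in> cball x R")
          case True
          hence w: "?w (x - y) \<noteq> 0" using elim by blast
          let ?v = "x - y"
          have wv: "norm (?w ?v) \<le> norm ?v" by (rule norm_perp_le[OF subspace_span])
          have v: "0 < norm ?v" "norm ?v \<le> R" using True wv w by (auto simp: dist_norm)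
          obtain j where j: "R / 2 ^ Suc j < norm ?v" "norm ?v \<le> R / 2 ^ j"
            using ex_dyadic_scale[OF v] .
          obtain i where i: "(R / 2 ^ j) / 2 ^ Suc i < norm (?w ?v)" "norm (?w ?v) \<le> (R / 2 ^ j) / 2 ^ i"
            using ex_dyadic_scale[of "norm (?w ?v)" "R / 2 ^ j"] w wv j by auto
          have 1: "riesz t ?v \<le> ennreal ((r j / 2) powr (- t))"
            using j rpos[of j] t by (intro riesz_le) (auto simp: r_def field_simps)
          have 2: "riesz s (?w ?v) \<le> ennreal ((\<sigma> j i / 2) powr (- s))"
            using i \<sigma>pos[of j i] s by (intro riesz_le) (auto simp: \<sigma>_def power_add field_simps)
          have "y \<in> ?T j i" using j i by (simp add: r_def \<sigma>_def power_add field_simps)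
          hence "riesz t ?v * riesz s (?w ?v) * indicator (cball x R) y
              \<le> ennreal (c j i) * indicator (?T j i) y"
            using mult_mono[OF 1 2] True by (simp add: c_def ennreal_mult)
          also have "\<dots> \<le> (\<Sum>i. ennreal (c j i) * indicator (?T j i) y)"
            by (rule ennreal_le_suminf)
          also have "\<dots> \<le> (\<Sum>j. \<Sum>i. ennreal (c j i) * indicator (?T j i) y)"
            by (rule ennreal_le_suminf)
          finally show ?thesis .
        qed simp
      qed
    qed
    also have "\<dots> = (\<Sum>j. \<Sum>i. ennreal (c j i) * emeasure \<mu> (?T j i))"
      by (simp add: nn_integral_suminf nn_integral_cmult_indicator)
    also have "\<dots> \<le> (\<Sum>j. \<Sum>i. ennreal (D * a ^ j * b ^ i))"
    proof (intro suminf_le allI)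
      fix j i
      have "ennreal (c j i) * emeasure \<mu> (?T j i)
        \<le> ennreal (c j i) * ennreal (5 * 2 powr q * C * r j * \<sigma> j i powr (q - 1))"
        by (intro mult_left_mono emeasure_tube_le e \<sigma>pos \<sigma>r) simp
      also have "\<dots> = ennreal (D * a ^ j * b ^ i)"
        unfolding prod[symmetric] using C_nonneg rpos[of j]
        by (subst ennreal_mult) (auto simp: c_def)
      finally show "ennreal (c j i) * emeasure \<mu> (?T j i) \<le> ennreal (D * a ^ j * b ^ i)" .
    qed auto
    also have "\<dots> = (\<Sum>j. ennreal (D * a ^ j / (1 - b)))"
    proof (rule suminf_cong)
      fix j
      have "(\<lambda>i. D * a ^ j * b ^ i) sums (D * a ^ j * (1 / (1 - b)))"
        using ab by (intro sums_mult geometric_sums) auto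
      thus "(\<Sum>i. ennreal (D * a ^ j * b ^ i)) = ennreal (D * a ^ j / (1 - b))"
        using D ab by (intro suminf_ennreal_eq) auto
    qed
    also have "\<dots> = ennreal (D / (1 - a) / (1 - b))"
    proof -
      have "(\<lambda>j. D * a ^ j / (1 - b)) sums (D * (1 / (1 - a)) / (1 - b))"
        using ab by (intro sums_mult sums_divide geometric_sums) auto
      thus ?thesis using D ab by (intro suminf_ennreal_eq) auto
    qed
    finally show ?thesis .
  qed
  thus ?thesis by blast
qed

end

section \<open>Energy of thin slabs around almost every plane\<close>

context frostman
begin

definition slab_energy :: "real \<Rightarrow> (real^'n) set \<Rightarrow> real \<Rightarrow> ennreal" where
  "slab_energy t P \<delta> =
    (\<integral>\<^sup>+p. indicator {v. norm (perp P v) \<le> \<delta>} (fst p - snd p) * riesz t (fst p - snd p) \<partial>(\<mu> \<Otimes>\<^sub>M \<mu>))"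

text \<open>
  After exchanging the integrals, transversality replaces the probability that \<open>|perp P (x - y)| \<le> \<delta>\<close>
  by the weight in \<open>weighted_potential_bounded\<close>. Almost all \<open>x\<close> and \<open>y\<close> lie in \<open>F\<close>, so the
  potential is only needed on a ball of radius \<open>2 * B\<close>.
\<close>

lemma nn_integral_slab_energy_le:
  fixes e :: "real^'n"
  assumes e: "norm e = 1" and \<nu>: "invariant_line_measure ({e}\<^sup>\<bottom>) \<nu>"
    and F: "bounded F" "F \<in> sets borel" "emeasure \<mu> F = 1"
    and m: "0 < CARD('n) - 2" "real (CARD('n) - 2) + 1 < q"
    and t: "0 < t" "t + real (CARD('n) - 2) < q"
  shows "\<exists>K\<ge>0. \<forall>\<delta>>0. (\<integral>\<^sup>+P. slab_energy t P \<delta> \<partial>planes_through_measure e \<nu>) \<le> ennreal (K * \<delta> ^ (CARD('n) - 2))"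
proof -
  let ?m = "CARD('n) - 2" and ?w = "perp (span {e})"
  let ?\<gamma> = "planes_through_measure e \<nu>"
  let ?C = "transversality_const TYPE('n)"
  obtain B where B: "\<And>x. x \<in> F \<Longrightarrow> norm x \<le> B" "B > 0"
    using F(1) unfolding bounded_pos by blast
  have R: "2 * B > 0" using B(2) by simp
  obtain K where K: "\<And>x. (\<integral>\<^sup>+y. riesz t (x - y) * riesz ?m (?w (x - y)) * indicator (cball x (2*B)) y \<partial>\<mu>) \<le> ennreal K"
    using weighted_potential_bounded[OF e _ m(2) t R] m(1) of_nat_0_less_iff by blast
  have C0: "?C \<ge> 0" by (simp add: transversality_const_def)
  interpret G: prob_space ?\<gamma> by (rule prob_space_planes_through_measure[OF e \<nu>])
  interpret MM: pair_prob_space \<mu> \<mu> ..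
  interpret GM: pair_sigma_finite ?\<gamma> "\<mu> \<Otimes>\<^sub>M \<mu>" ..
  have AEF: "AE x in \<mu>. x \<in> F"
    using F by (intro AE_prob_1) (simp add: emeasure_eq_measure)
  have [measurable]: "cball x r \<in> sets borel" for x :: "real^'n" and r by (intro borel_closed closed_cball)
  have wm [measurable]: "?w \<in> borel_measurable borel"
    using borel_measurable_perp[OF subspace_span, of "\<lambda>y. y" borel "{e}"] by simp
  show ?thesis
  proof (intro exI[of _ "?C * max 0 K"] conjI allI impI)
    show "0 \<le> ?C * max 0 K" using C0 by simp
    fix \<delta> :: real assume \<delta>: "\<delta> > 0"
    define h where "h P p = indicator {v. norm (perp P v) \<le> \<delta>} (fst p - snd p) * riesz t (fst p - snd p)"
      for P and p :: "(real^'n) \<times> (real^'n)"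
    have hm: "case_prod h \<in> borel_measurable (?\<gamma> \<Otimes>\<^sub>M (\<mu> \<Otimes>\<^sub>M \<mu>))"
    proof -
      have 1: "(\<lambda>z. (fst z, fst (snd z) - snd (snd z))) \<in> measurable (?\<gamma> \<Otimes>\<^sub>M (\<mu> \<Otimes>\<^sub>M \<mu>)) (?\<gamma> \<Otimes>\<^sub>M borel)"
        by measurable
      have [measurable]: "(\<lambda>z. perp (fst z) (fst (snd z) - snd (snd z))) \<in> borel_measurable (?\<gamma> \<Otimes>\<^sub>M (\<mu> \<Otimes>\<^sub>M \<mu>))"
        using measurable_compose[OF 1 borel_measurable_perp_planes[OF e \<nu>]] by simp
      have "(\<lambda>z. (if norm (perp (fst z) (fst (snd z) - snd (snd z))) \<le> \<delta> then 1 else 0) *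
          riesz t (fst (snd z) - snd (snd z))) \<in> borel_measurable (?\<gamma> \<Otimes>\<^sub>M (\<mu> \<Otimes>\<^sub>M \<mu>))"
        by measurable
      also have "(\<lambda>z. (if norm (perp (fst z) (fst (snd z) - snd (snd z))) \<le> \<delta> then 1 else 0) *
          riesz t (fst (snd z) - snd (snd z))) = case_prod h"
        by (auto simp: h_def fun_eq_iff)
      finally show ?thesis .
    qed
    have "(\<integral>\<^sup>+P. slab_energy t P \<delta> \<partial>?\<gamma>) = (\<integral>\<^sup>+P. (\<integral>\<^sup>+p. h P p \<partial>(\<mu> \<Otimes>\<^sub>M \<mu>)) \<partial>?\<gamma>)"
      by (simp add: slab_energy_def h_def)
    also have "\<dots> = (\<integral>\<^sup>+p. (\<integral>\<^sup>+P. h P p \<partial>?\<gamma>) \<partial>(\<mu> \<Otimes>\<^sub>M \<mu>))"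
      by (rule GM.Fubini'[OF hm, symmetric])
    also have "\<dots> = (\<integral>\<^sup>+x. (\<integral>\<^sup>+y. (\<integral>\<^sup>+P. h P (x, y) \<partial>?\<gamma>) \<partial>\<mu>) \<partial>\<mu>)"
    proof (rule nn_integral_fst[symmetric])
      show "(\<lambda>p. \<integral>\<^sup>+P. h P p \<partial>?\<gamma>) \<in> borel_measurable (\<mu> \<Otimes>\<^sub>M \<mu>)"
      proof (rule G.borel_measurable_nn_integral)
        have "(\<lambda>z. case_prod h (snd z, fst z)) \<in> borel_measurable ((\<mu> \<Otimes>\<^sub>M \<mu>) \<Otimes>\<^sub>M ?\<gamma>)"
          by (rule measurable_compose[OF _ hm]) measurable
        thus "(\<lambda>(p, P). h P p) \<in> borel_measurable ((\<mu> \<Otimes>\<^sub>M \<mu>) \<Otimes>\<^sub>M ?\<gamma>)"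
          by (simp add: case_prod_beta)
      qed
    qed
    also have "\<dots> \<le> (\<integral>\<^sup>+x. ennreal (?C * \<delta> ^ ?m) * ennreal K \<partial>\<mu>)"
    proof (rule nn_integral_mono_AE)
      show "AE x in \<mu>. (\<integral>\<^sup>+y. (\<integral>\<^sup>+P. h P (x, y) \<partial>?\<gamma>) \<partial>\<mu>) \<le> ennreal (?C * \<delta> ^ ?m) * ennreal K"
        using AEF
      proof eventually_elim
        case (elim x)
        have "(\<integral>\<^sup>+y. (\<integral>\<^sup>+P. h P (x, y) \<partial>?\<gamma>) \<partial>\<mu>) \<le>
          (\<integral>\<^sup>+y. ennreal (?C * \<delta> ^ ?m) * (riesz t (x - y) * riesz ?m (?w (x - y)) * indicator (cball x (2*B)) y) \<partial>\<mu>)"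
        proof (rule nn_integral_mono_AE)
          have q1: "q > 1" using m by simp
          show "AE y in \<mu>. (\<integral>\<^sup>+P. h P (x, y) \<partial>?\<gamma>) \<le>
            ennreal (?C * \<delta> ^ ?m) * (riesz t (x - y) * riesz ?m (?w (x - y)) * indicator (cball x (2*B)) y)"
            using AEF AE_off_line[OF e q1 R, of x]
          proof eventually_elim
            case (elim y)
            have "norm (x - y) \<le> 2 * B"
              using norm_triangle_ineq4[of x y] B(1)[OF \<open>x \<in> F\<close>] B(1)[OF \<open>y \<in> F\<close>] by linarith
            hence xy: "y \<in> cball x (2*B)" by (simp add: dist_norm)
            hence w: "?w (x - y) \<noteq> 0" using elim by blast
            let ?S = "{P \<in> space ?\<gamma>. norm (perp P (x - y)) \<le> \<delta>}"
            have [measurable]: "(\<lambda>P. perp P (x - y)) \<in> borel_measurable ?\<gamma>"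
              by (rule borel_measurable_perp_fst[OF e \<nu>])
            have "(\<integral>\<^sup>+P. h P (x, y) \<partial>?\<gamma>) = (\<integral>\<^sup>+P. riesz t (x - y) * indicator ?S P \<partial>?\<gamma>)"
              by (intro nn_integral_cong) (auto simp: h_def indicator_def)
            also have "\<dots> = riesz t (x - y) * emeasure ?\<gamma> ?S"
              by (rule nn_integral_cmult_indicator) measurable
            also have "\<dots> \<le> riesz t (x - y) * ennreal (?C * (\<delta> / norm (?w (x - y))) ^ ?m)"
              using \<delta> by (intro mult_left_mono transversality[OF e \<nu> _ w]) auto
            also have "ennreal (?C * (\<delta> / norm (?w (x - y))) ^ ?m) = ennreal (?C * \<delta> ^ ?m) * riesz ?m (?w (x - y))"
            proof -
              have "norm (?w (x - y)) powr (- real ?m) = 1 / norm (?w (x - y)) ^ ?m"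
                using w by (simp add: powr_minus powr_realpow divide_inverse)
              hence "?C * (\<delta> / norm (?w (x - y))) ^ ?m = (?C * \<delta> ^ ?m) * norm (?w (x - y)) powr (- real ?m)"
                by (simp add: power_divide)
              hence "ennreal (?C * (\<delta> / norm (?w (x - y))) ^ ?m) =
                  ennreal ((?C * \<delta> ^ ?m) * norm (?w (x - y)) powr (- real ?m))"
                by (simp only:)
              also have "\<dots> = ennreal (?C * \<delta> ^ ?m) * ennreal (norm (?w (x - y)) powr (- real ?m))"
                using C0 \<delta> by (intro ennreal_mult) auto
              finally show ?thesis using w by (simp only: riesz_eq not_False_eq_True)
            qed
            finally show ?case using xy by (simp add: mult_ac)
          qed
        qed
        also have "\<dots> = ennreal (?C * \<delta> ^ ?m) *
            (\<integral>\<^sup>+y. riesz t (x - y) * riesz ?m (?w (x - y)) * indicator (cball x (2*B)) y \<partial>\<mu>)"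
          by (rule nn_integral_cmult) measurable
        also have "\<dots> \<le> ennreal (?C * \<delta> ^ ?m) * ennreal K" by (intro mult_left_mono K) simp
        finally show ?case .
      qed
    qed
    also have "\<dots> = ennreal (?C * \<delta> ^ ?m) * ennreal (max 0 K)"
      by (simp add: emeasure_space_1 max_def ennreal_neg)
    also have "\<dots> = ennreal (?C * max 0 K * \<delta> ^ ?m)"
      using C0 \<delta> by (subst ennreal_mult[symmetric]) (auto simp: mult_ac)
    finally show "(\<integral>\<^sup>+P. slab_energy t P \<delta> \<partial>?\<gamma>) \<le> ennreal (?C * max 0 K * \<delta> ^ ?m)" .
  qed
qed

text \<open>
  Fatou's lemma, applied to the energies divided by the powers of the widths, gives a finite lower
  limit for almost every plane. The estimate thus holds for infinitely many \<open>k\<close>, and which \<open>k\<close> these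
  are depends on the plane.
\<close>

lemma AE_slab_energy:
  fixes e :: "real^'n"
  assumes e: "norm e = 1" and \<nu>: "invariant_line_measure ({e}\<^sup>\<bottom>) \<nu>"
    and F: "bounded F" "F \<in> sets borel" "emeasure \<mu> F = 1"
    and m: "0 < CARD('n) - 2" "real (CARD('n) - 2) + 1 < q"
    and t: "0 < t" "t + real (CARD('n) - 2) < q"
    and \<delta>: "\<And>k::nat. \<delta> k > 0"
  shows "AE P in planes_through_measure e \<nu>.
    \<exists>M>0. \<exists>\<^sub>F k in sequentially. slab_energy t P (\<delta> k) \<le> ennreal (M * \<delta> k ^ (CARD('n) - 2))"
proof -
  let ?m = "CARD('n) - 2"
  let ?\<gamma> = "planes_through_measure e \<nu>"
  interpret MM: pair_prob_space \<mu> \<mu> ..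
  obtain K where K: "K \<ge> 0" "\<And>\<delta>. \<delta> > 0 \<Longrightarrow> (\<integral>\<^sup>+P. slab_energy t P \<delta> \<partial>?\<gamma>) \<le> ennreal (K * \<delta> ^ ?m)"
    using nn_integral_slab_energy_le[OF e \<nu> F m t] by blast
  define u where "u k P = slab_energy t P (\<delta> k) * ennreal (1 / \<delta> k ^ ?m)" for k P
  have sm: "(\<lambda>P. slab_energy t P d) \<in> borel_measurable ?\<gamma>" for d
    unfolding slab_energy_def
  proof (rule MM.P.borel_measurable_nn_integral)
    have 1: "(\<lambda>z. (fst z, fst (snd z) - snd (snd z))) \<in> measurable (?\<gamma> \<Otimes>\<^sub>M (\<mu> \<Otimes>\<^sub>M \<mu>)) (?\<gamma> \<Otimes>\<^sub>M borel)"
      by measurable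
    have [measurable]: "(\<lambda>z. perp (fst z) (fst (snd z) - snd (snd z))) \<in> borel_measurable (?\<gamma> \<Otimes>\<^sub>M (\<mu> \<Otimes>\<^sub>M \<mu>))"
      using measurable_compose[OF 1 borel_measurable_perp_planes[OF e \<nu>]] by simp
    have "(\<lambda>z. (if norm (perp (fst z) (fst (snd z) - snd (snd z))) \<le> d then 1 else 0) *
        riesz t (fst (snd z) - snd (snd z))) \<in> borel_measurable (?\<gamma> \<Otimes>\<^sub>M (\<mu> \<Otimes>\<^sub>M \<mu>))"
      by measurable
    also have "(\<lambda>z. (if norm (perp (fst z) (fst (snd z) - snd (snd z))) \<le> d then 1 else 0) *
        riesz t (fst (snd z) - snd (snd z))) =
        (\<lambda>(P, p). indicator {v. norm (perp P v) \<le> d} (fst p - snd p) * riesz t (fst p - snd p))"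
      by (auto simp: fun_eq_iff)
    finally show "(\<lambda>(P, p). indicator {v. norm (perp P v) \<le> d} (fst p - snd p) * riesz t (fst p - snd p))
        \<in> borel_measurable (?\<gamma> \<Otimes>\<^sub>M (\<mu> \<Otimes>\<^sub>M \<mu>))" .
  qed
  hence um: "u k \<in> borel_measurable ?\<gamma>" for k unfolding u_def by measurable
  have "(\<integral>\<^sup>+P. liminf (\<lambda>k. u k P) \<partial>?\<gamma>) \<le> liminf (\<lambda>k. integral\<^sup>N ?\<gamma> (u k))"
    by (rule nn_integral_liminf[OF um])
  also have "\<dots> \<le> liminf (\<lambda>k::nat. ennreal K)"
  proof (intro Liminf_mono always_eventually allI)
    fix k
    have "integral\<^sup>N ?\<gamma> (u k) = (\<integral>\<^sup>+P. slab_energy t P (\<delta> k) \<partial>?\<gamma>) * ennreal (1 / \<delta> k ^ ?m)"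
      unfolding u_def by (rule nn_integral_multc[OF sm])
    also have "\<dots> \<le> ennreal (K * \<delta> k ^ ?m) * ennreal (1 / \<delta> k ^ ?m)"
      by (intro mult_right_mono K \<delta>) simp
    also have "\<dots> = ennreal K" using K(1) \<delta>[of k] by (subst ennreal_mult[symmetric]) auto
    finally show "integral\<^sup>N ?\<gamma> (u k) \<le> ennreal K" .
  qed
  also have "\<dots> = ennreal K" by (rule Liminf_const) simp
  finally have "(\<integral>\<^sup>+P. liminf (\<lambda>k. u k P) \<partial>?\<gamma>) \<noteq> \<infinity>" by (auto simp: top_unique)
  hence "AE P in ?\<gamma>. liminf (\<lambda>k. u k P) \<noteq> \<infinity>"
    using um by (intro nn_integral_PInf_AE) measurable
  thus ?thesis
  proof eventually_elim
    case (elim P)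
    then obtain M where M: "liminf (\<lambda>k. u k P) < ennreal M" "M > 0"
    proof -
      obtain l where l: "l \<ge> 0" "liminf (\<lambda>k. u k P) = ennreal l"
        using elim by (metis ennreal_cases infinity_ennreal_def)
      have "ennreal l < ennreal (l + 1)" using l by (simp add: ennreal_less_iff)
      thus ?thesis using that[of "l + 1"] l by simp
    qed
    have "\<exists>\<^sub>F k in sequentially. u k P < ennreal M"
    proof (rule ccontr)
      assume "\<not> (\<exists>\<^sub>F k in sequentially. u k P < ennreal M)"
      hence "\<forall>\<^sub>F k in sequentially. ennreal M \<le> u k P" by (simp add: not_frequently not_less)
      from Liminf_bounded[OF this] M(1) show False by simp
    qed
    hence "\<exists>\<^sub>F k in sequentially. slab_energy t P (\<delta> k) \<le> ennreal (M * \<delta> k ^ ?m)"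
    proof (rule frequently_elim1)
      fix k assume "u k P < ennreal M"
      have "slab_energy t P (\<delta> k) = u k P * ennreal (\<delta> k ^ ?m)"
        using \<delta>[of k] unfolding u_def mult.assoc by (subst ennreal_mult[symmetric]) auto
      also have "\<dots> \<le> ennreal M * ennreal (\<delta> k ^ ?m)"
        using \<open>u k P < ennreal M\<close> by (intro mult_right_mono) auto
      also have "\<dots> = ennreal (M * \<delta> k ^ ?m)" using M \<delta>[of k] by (subst ennreal_mult) auto
      finally show "slab_energy t P (\<delta> k) \<le> ennreal (M * \<delta> k ^ ?m)" .
    qed
    thus ?case using M(2) by blast
  qed
qed

end

section \<open>Sets of Hausdorff measure zero\<close>

lemma ennreal_geometric_half:
  assumes "\<epsilon> \<ge> 0"
  shows "(\<Sum>i. ennreal (\<epsilon> * (1/2) ^ Suc i)) = ennreal \<epsilon>"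
proof -
  have "(\<lambda>i. \<epsilon> * (1/2) ^ Suc i) sums (\<epsilon> * 1)"
    using power_half_series by (intro sums_mult)
  thus ?thesis using assms by (intro suminf_ennreal_eq) auto
qed

text \<open>
  A cover at scale \<open>1\<close> with small sum of \<open>s\<close>-th powers is fattened: \<open>\<rho> i powr t\<close> exceeds the \<open>t\<close>-th
  power of the diameter by a term of a convergent series. This makes the sets open, for
  compactness arguments, and the numbers \<open>\<rho> i\<close> positive, so that negative powers of them are
  meaningful.
\<close>

lemma hausdorff_null_imp_open_cover:
  fixes A :: "(real^'n) set"
  assumes H: "hausdorff_measure s A = 0" and s: "0 \<le> s" "s \<le> t" and t: "0 < t" and \<epsilon>: "\<epsilon> > 0"
  shows "\<exists>(V :: nat \<Rightarrow> (real^'n) set) \<rho>. A \<subseteq> (\<Union>i. V i) \<and> (\<forall>i. open (V i)) \<and> (\<forall>i. \<rho> i > 0) \<and>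
    (\<forall>i. \<forall>x\<in>V i. \<forall>y\<in>V i. norm (x - y) \<le> \<rho> i) \<and> (\<Sum>i. ennreal (\<rho> i powr t)) \<le> ennreal \<epsilon>"
proof -
  have "hausdorff_premeasure s 1 A \<le> hausdorff_measure s A"
    unfolding hausdorff_measure_def by (rule SUP_upper) simp
  hence "hausdorff_premeasure s 1 A < ennreal (\<epsilon> / 2)" using H \<epsilon> by (simp add: order.strict_trans1)
  then obtain U :: "nat \<Rightarrow> (real^'n) set" where U: "A \<subseteq> (\<Union>i. U i)" "\<And>i. bounded (U i)" "\<And>i. diameter (U i) \<le> 1"
    "(\<Sum>i. diam_pow s (U i)) < ennreal (\<epsilon> / 2)"
    unfolding hausdorff_premeasure_def INF_less_iff by auto
  define d where "d i = diameter (U i)" for i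
  define \<eta> where "\<eta> i = \<epsilon> / 2 * (1/2) ^ Suc i" for i :: nat
  define \<rho> where "\<rho> i = (d i powr t + \<eta> i) powr (1 / t)" for i
  define V where "V i = (\<Union>y\<in>U i. ball y ((\<rho> i - d i) / 2))" for i
  have d0: "d i \<ge> 0" for i using diameter_ge_0[OF U(2)] by (simp add: d_def)
  have \<eta>0: "\<eta> i > 0" for i using \<epsilon> by (simp add: \<eta>_def)
  have \<rho>t: "\<rho> i powr t = d i powr t + \<eta> i" for i
    using t \<eta>0[of i] by (simp add: \<rho>_def powr_powr add_nonneg_pos less_imp_le)
  have \<rho>d: "d i < \<rho> i" for i
  proof (rule ccontr)
    assume "\<not> d i < \<rho> i"
    hence "\<rho> i powr t \<le> d i powr t" using t by (intro powr_mono2) (auto simp: \<rho>_def)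
    thus False using \<rho>t[of i] \<eta>0[of i] by simp
  qed
  show ?thesis
  proof (intro exI[of _ V] exI[of _ \<rho>] conjI allI ballI)
    have "U i \<subseteq> V i" for i
    proof (rule subsetI)
      fix y assume "y \<in> U i"
      moreover have "y \<in> ball y ((\<rho> i - d i) / 2)" using \<rho>d[of i] by simp
      ultimately show "y \<in> V i" unfolding V_def by (rule UN_I)
    qed
    hence "(\<Union>i. U i) \<subseteq> (\<Union>i. V i)" by (intro UN_mono) auto
    with U(1) show "A \<subseteq> (\<Union>i. V i)" by (rule subset_trans)
    show "open (V i)" for i by (auto simp: V_def)
    show "\<rho> i > 0" for i using d0[of i] \<rho>d[of i] by linarith
    show "norm (x - y) \<le> \<rho> i" if xyV: "x \<in> V i" "y \<in> V i" for i x y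
    proof -
      obtain x' y' where xy: "x' \<in> U i" "y' \<in> U i" "dist x' x < (\<rho> i - d i) / 2" "dist y' y < (\<rho> i - d i) / 2"
        using xyV by (auto simp: V_def)
      have "dist x' y' \<le> d i" unfolding d_def using U(2) xy by (intro diameter_bounded_bound) auto
      moreover have "dist x y \<le> dist x' x + dist x' y' + dist y' y"
        using dist_triangle[of x y x'] dist_triangle[of x' y y'] by (simp add: dist_commute)
      moreover have "dist x' x + dist y' y < \<rho> i - d i"
        using add_strict_mono[OF xy(3,4)] by (simp only: field_sum_of_halves)
      ultimately have "dist x y \<le> \<rho> i" by linarith
      thus ?thesis by (simp add: dist_norm)
    qed
    have le: "ennreal (d i powr t) \<le> diam_pow s (U i)" for i
    proof (cases "U i = {}")
      case False
      show ?thesis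
      proof (cases "s = 0")
        case True
        have "d i powr t \<le> 1" using powr_mono2[of t "d i" 1] t d0[of i] U(3)[of i] by (simp add: d_def)
        thus ?thesis using True False by (simp add: diam_pow_def)
      next
        case s0: False
        have "d i powr t \<le> d i powr s"
          using powr_mono'[of s t "d i"] s d0[of i] U(3)[of i] by (simp add: d_def)
        thus ?thesis using s0 False by (simp add: diam_pow_def d_def ennreal_leI)
      qed
    qed (simp add: d_def)
    have "(\<Sum>i. ennreal (\<rho> i powr t)) = (\<Sum>i. ennreal (d i powr t) + ennreal (\<eta> i))"
      by (intro suminf_cong) (use \<eta>0 in \<open>simp add: \<rho>t less_imp_le\<close>)
    also have "\<dots> = (\<Sum>i. ennreal (d i powr t)) + (\<Sum>i. ennreal (\<eta> i))"
      by (rule suminf_add[symmetric]) auto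
    also have "\<dots> \<le> ennreal (\<epsilon> / 2) + ennreal (\<epsilon> / 2)"
    proof (rule add_mono)
      have "(\<Sum>i. ennreal (d i powr t)) \<le> (\<Sum>i. diam_pow s (U i))"
        by (intro suminf_le le) auto
      thus "(\<Sum>i. ennreal (d i powr t)) \<le> ennreal (\<epsilon> / 2)" using U(4) by simp
      have "(\<Sum>i. ennreal (\<eta> i)) = ennreal (\<epsilon> / 2)"
        unfolding \<eta>_def by (rule ennreal_geometric_half) (use \<epsilon> in simp)
      thus "(\<Sum>i. ennreal (\<eta> i)) \<le> ennreal (\<epsilon> / 2)" by (rule eq_refl)
    qed
    also have "\<dots> = ennreal \<epsilon>" using \<epsilon> by (subst ennreal_plus[symmetric]) auto
    finally show "(\<Sum>i. ennreal (\<rho> i powr t)) \<le> ennreal \<epsilon>" .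
  qed
qed

section \<open>Covers and energy\<close>

context frostman
begin

definition energy :: "real \<Rightarrow> (real^'n) set \<Rightarrow> ennreal" where
  "energy t T = (\<integral>\<^sup>+p. indicator (T \<times> T) p * riesz t (fst p - snd p) \<partial>(\<mu> \<Otimes>\<^sub>M \<mu>))"

lemma borel_measurable_riesz_diff [measurable]:
  "(\<lambda>p. riesz t (fst p - snd p)) \<in> borel_measurable (\<mu> \<Otimes>\<^sub>M \<mu>)"
  by measurable

lemma sets_Times_mu [measurable]: "A \<in> sets borel \<Longrightarrow> B \<in> sets borel \<Longrightarrow> A \<times> B \<in> sets (\<mu> \<Otimes>\<^sub>M \<mu>)"
  by (intro pair_measureI) (simp_all add: sets_mu)

lemma energy_split:
  assumes T: "T \<in> sets borel" and V: "V \<in> sets borel"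
  shows "energy t (T \<inter> V) + energy t (T - V) \<le> energy t T"
proof -
  note [measurable] = T V
  have "energy t (T \<inter> V) + energy t (T - V) =
      (\<integral>\<^sup>+p. indicator ((T \<inter> V) \<times> (T \<inter> V)) p * riesz t (fst p - snd p) +
         indicator ((T - V) \<times> (T - V)) p * riesz t (fst p - snd p) \<partial>(\<mu> \<Otimes>\<^sub>M \<mu>))"
    unfolding energy_def by (rule nn_integral_add[symmetric]) measurable
  also have "\<dots> \<le> energy t T"
    unfolding energy_def by (intro nn_integral_mono) (auto simp: indicator_def)
  finally show ?thesis .
qed

lemma energy_ge:
  assumes T: "T \<in> sets borel" and \<rho>: "\<And>x y. x \<in> T \<Longrightarrow> y \<in> T \<Longrightarrow> norm (x - y) \<le> \<rho>" and t: "t \<ge> 0"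
  shows "ennreal (\<rho> powr (- t)) * (emeasure \<mu> T)\<^sup>2 \<le> energy t T"
proof -
  interpret MM: pair_prob_space \<mu> \<mu> ..
  note [measurable] = T
  have "ennreal (\<rho> powr (- t)) * (emeasure \<mu> T)\<^sup>2 = ennreal (\<rho> powr (- t)) * emeasure (\<mu> \<Otimes>\<^sub>M \<mu>) (T \<times> T)"
    using T by (subst emeasure_pair_measure_Times) (auto simp: sets_mu power2_eq_square)
  also have "\<dots> = (\<integral>\<^sup>+p. ennreal (\<rho> powr (- t)) * indicator (T \<times> T) p \<partial>(\<mu> \<Otimes>\<^sub>M \<mu>))"
    by (rule nn_integral_cmult_indicator[symmetric]) measurable
  also have "\<dots> \<le> energy t T"
    unfolding energy_def
  proof (rule nn_integral_mono)
    fix p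
    show "ennreal (\<rho> powr (- t)) * indicator (T \<times> T) p \<le> indicator (T \<times> T) p * riesz t (fst p - snd p)"
    proof (cases "p \<in> T \<times> T")
      case True
      hence "norm (fst p - snd p) \<le> \<rho>" using \<rho> by auto
      thus ?thesis using True riesz_ge[OF _ t] by simp
    qed simp
  qed
  finally show ?thesis .
qed

text \<open>
  With \<open>y = \<beta> * \<rho> powr t\<close>, the inequality \<open>x \<le> y + x\<^sup>2 / (4 * y)\<close> is applied to the mass \<open>x\<close>, whose
  square is at most \<open>\<rho> powr t\<close> times the energy. Being additive in both terms, this form can be
  summed over disjoint pieces.
\<close>

lemma emeasure_le_piece:
  assumes T: "T \<in> sets borel" and \<rho>: "\<And>x y. x \<in> T \<Longrightarrow> y \<in> T \<Longrightarrow> norm (x - y) \<le> \<rho>" "\<rho> > 0"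
    and t: "t \<ge> 0" and \<beta>: "\<beta> > 0"
  shows "emeasure \<mu> T \<le> ennreal (\<beta> * \<rho> powr t) + ennreal (1 / (4 * \<beta>)) * energy t T"
proof -
  define x where "x = measure \<mu> T"
  define y where "y = \<beta> * \<rho> powr t"
  have y: "y > 0" using \<rho>(2) \<beta> by (simp add: y_def)
  have "0 \<le> (x - 2 * y)\<^sup>2" by simp
  hence "x * (4 * y) \<le> 4 * y\<^sup>2 + x\<^sup>2" by (simp add: power2_eq_square algebra_simps)
  hence "x \<le> y + x\<^sup>2 / (4 * y)" using y by (simp add: field_simps power2_eq_square)
  also have "x\<^sup>2 / (4 * y) = 1 / (4 * \<beta>) * (\<rho> powr (- t) * x\<^sup>2)"
    using \<beta> by (simp add: y_def powr_minus field_simps)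
  finally have "ennreal x \<le> ennreal (y + 1 / (4 * \<beta>) * (\<rho> powr (- t) * x\<^sup>2))" by (rule ennreal_leI)
  also have "\<dots> = ennreal y + ennreal (1 / (4 * \<beta>)) * (ennreal (\<rho> powr (- t)) * (emeasure \<mu> T)\<^sup>2)"
  proof -
    have "ennreal (y + 1 / (4 * \<beta>) * (\<rho> powr (- t) * x\<^sup>2)) =
        ennreal y + ennreal (1 / (4 * \<beta>) * (\<rho> powr (- t) * x\<^sup>2))"
      using y \<beta> by (intro ennreal_plus) auto
    also have "ennreal (1 / (4 * \<beta>) * (\<rho> powr (- t) * x\<^sup>2)) = ennreal (1 / (4 * \<beta>)) * ennreal (\<rho> powr (- t) * x\<^sup>2)"
      using \<beta> by (intro ennreal_mult) auto
    also have "ennreal (\<rho> powr (- t) * x\<^sup>2) = ennreal (\<rho> powr (- t)) * ennreal (x\<^sup>2)"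
      by (intro ennreal_mult) auto
    also have "ennreal (x\<^sup>2) = (emeasure \<mu> T)\<^sup>2"
      by (simp add: x_def emeasure_eq_measure ennreal_power)
    finally show ?thesis .
  qed
  also have "\<dots> \<le> ennreal y + ennreal (1 / (4 * \<beta>)) * energy t T"
    by (intro add_left_mono mult_left_mono energy_ge T \<rho>(1) t) auto
  finally show ?thesis by (simp add: x_def y_def emeasure_eq_measure)
qed

text \<open>
  The cover is made disjoint by cutting off one set at a time; the energies of disjoint pieces add
  up to at most the total energy, because their squares are disjoint in the product.
\<close>

lemma emeasure_le_cover_energy:
  assumes I: "finite I" and T: "T \<in> sets borel" "T \<subseteq> (\<Union>i\<in>I. V i)"
    and V: "\<And>i. V i \<in> sets borel" and \<rho>: "\<And>i x y. x \<in> V i \<Longrightarrow> y \<in> V i \<Longrightarrow> norm (x - y) \<le> \<rho> i" "\<And>i. \<rho> i > 0"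
    and t: "t \<ge> 0" and \<beta>: "\<beta> > 0"
  shows "emeasure \<mu> T \<le> ennreal (\<beta> * (\<Sum>i\<in>I. \<rho> i powr t)) + ennreal (1 / (4 * \<beta>)) * energy t T"
  using I T
proof (induction I arbitrary: T)
  case empty
  thus ?case by simp
next
  case (insert i I)
  let ?b = "ennreal (1 / (4 * \<beta>))"
  have s: "T \<inter> V i \<in> sets borel" "T - V i \<in> sets borel" using insert.prems V by auto
  have 1: "emeasure \<mu> (T \<inter> V i) \<le> ennreal (\<beta> * \<rho> i powr t) + ?b * energy t (T \<inter> V i)"
    by (rule emeasure_le_piece) (use s \<rho> t \<beta> in auto)
  have 2: "emeasure \<mu> (T - V i) \<le> ennreal (\<beta> * (\<Sum>i\<in>I. \<rho> i powr t)) + ?b * energy t (T - V i)"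
    by (rule insert.IH) (use s insert.prems in auto)
  have "emeasure \<mu> T = emeasure \<mu> (T \<inter> V i) + emeasure \<mu> (T - V i)"
    using s by (subst plus_emeasure) (auto simp: sets_mu Int_Diff_Un)
  also have "\<dots> \<le> (ennreal (\<beta> * \<rho> i powr t) + ?b * energy t (T \<inter> V i)) +
      (ennreal (\<beta> * (\<Sum>i\<in>I. \<rho> i powr t)) + ?b * energy t (T - V i))"
    by (rule add_mono[OF 1 2])
  also have "\<dots> = (ennreal (\<beta> * \<rho> i powr t) + ennreal (\<beta> * (\<Sum>i\<in>I. \<rho> i powr t))) +
      ?b * (energy t (T \<inter> V i) + energy t (T - V i))"
    by (simp add: distrib_left add_ac)
  also have "\<dots> \<le> (ennreal (\<beta> * \<rho> i powr t) + ennreal (\<beta> * (\<Sum>i\<in>I. \<rho> i powr t))) + ?b * energy t T"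
    by (intro add_left_mono mult_left_mono energy_split insert.prems V) auto
  also have "ennreal (\<beta> * \<rho> i powr t) + ennreal (\<beta> * (\<Sum>i\<in>I. \<rho> i powr t)) =
      ennreal (\<beta> * (\<Sum>i\<in>insert i I. \<rho> i powr t))"
    using insert.hyps \<beta> by (subst ennreal_plus[symmetric]) (auto simp: distrib_left sum_nonneg)
  finally show ?case .
qed

end

section \<open>Slices carrying much mass and little energy\<close>

definition slab_slice :: "(real^'n) set \<Rightarrow> (real^'n) set \<Rightarrow> real^'n \<Rightarrow> real \<Rightarrow> (real^'n) set" where
  "slab_slice P F z \<delta> = {x \<in> F. norm (perp P (z - x)) \<le> \<delta>}"

lemma sets_slab_slice:
  assumes "subspace P" "F \<in> sets borel"
  shows "slab_slice P F z \<delta> \<in> sets borel"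
proof -
  have "(\<lambda>x. perp P (z - x)) \<in> borel_measurable borel"
    using borel_measurable_perp[OF assms(1), of "\<lambda>x. z - x" borel] by simp
  hence "{x \<in> space borel. norm (perp P (z - x)) \<le> \<delta>} \<in> sets borel" by measurable
  hence "F \<inter> {x. norm (perp P (z - x)) \<le> \<delta>} \<in> sets borel" using assms(2) by auto
  thus ?thesis by (simp add: slab_slice_def Int_def)
qed

context frostman
begin

text \<open>
  With \<open>\<delta>\<^sup>m\<close> as unit of mass and its square as unit of energy, both sides of the inequality have the
  same scaling in \<open>\<delta>\<close>. The constants \<open>a\<close> and \<open>b\<close> are to be independent of \<open>\<delta>\<close>.
\<close>

definition heavy :: "real \<Rightarrow> real \<Rightarrow> real \<Rightarrow> (real^'n) set \<Rightarrow> (real^'n) set \<Rightarrow> real \<Rightarrow> (real^'n) set" where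
  "heavy t a b P F \<delta> = {z. ennreal (b * \<delta> ^ (CARD('n) - 2)) +
      ennreal (a / \<delta> ^ (CARD('n) - 2)) * energy t (slab_slice P F z \<delta>) < emeasure \<mu> (slab_slice P F z \<delta>)}"

lemma borel_measurable_slab_slice:
  assumes P: "subspace P" and F: "F \<in> sets borel"
  shows "(\<lambda>z. emeasure \<mu> (slab_slice P F z \<delta>)) \<in> borel_measurable borel"
    and "(\<lambda>z. energy t (slab_slice P F z \<delta>)) \<in> borel_measurable borel"
proof -
  interpret MM: pair_prob_space \<mu> \<mu> ..
  note [measurable] = F
  have pm: "(\<lambda>v. perp P v) \<in> borel_measurable borel"
    using borel_measurable_perp[OF P, of "\<lambda>v. v" borel] by simp
  have [measurable]: "perp P \<in> borel_measurable borel" using pm by simp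
  have "(\<lambda>z. \<integral>\<^sup>+x. (if x \<in> F \<and> norm (perp P (z - x)) \<le> \<delta> then 1 else 0) \<partial>\<mu>) \<in> borel_measurable borel"
    by (rule borel_measurable_nn_integral) measurable
  also have "(\<lambda>z. \<integral>\<^sup>+x. (if x \<in> F \<and> norm (perp P (z - x)) \<le> \<delta> then 1 else 0) \<partial>\<mu>) =
      (\<lambda>z. emeasure \<mu> (slab_slice P F z \<delta>))"
  proof
    fix z
    have "(\<integral>\<^sup>+x. (if x \<in> F \<and> norm (perp P (z - x)) \<le> \<delta> then 1 else 0) \<partial>\<mu>) =
        (\<integral>\<^sup>+x. indicator (slab_slice P F z \<delta>) x \<partial>\<mu>)"
      by (intro nn_integral_cong) (auto simp: slab_slice_def)
    also have "\<dots> = emeasure \<mu> (slab_slice P F z \<delta>)"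
      using sets_slab_slice[OF P F] by (simp add: sets_mu)
    finally show "(\<integral>\<^sup>+x. (if x \<in> F \<and> norm (perp P (z - x)) \<le> \<delta> then 1 else 0) \<partial>\<mu>) = \<dots>" .
  qed
  finally show "(\<lambda>z. emeasure \<mu> (slab_slice P F z \<delta>)) \<in> borel_measurable borel" .
  have "(\<lambda>z. \<integral>\<^sup>+p. (if fst p \<in> F \<and> norm (perp P (z - fst p)) \<le> \<delta> \<and> snd p \<in> F \<and> norm (perp P (z - snd p)) \<le> \<delta>
      then 1 else 0) * riesz t (fst p - snd p) \<partial>(\<mu> \<Otimes>\<^sub>M \<mu>)) \<in> borel_measurable borel"
    by (rule MM.P.borel_measurable_nn_integral) measurable
  also have "(\<lambda>z. \<integral>\<^sup>+p. (if fst p \<in> F \<and> norm (perp P (z - fst p)) \<le> \<delta> \<and> snd p \<in> F \<and> norm (perp P (z - snd p)) \<le> \<delta>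
      then 1 else 0) * riesz t (fst p - snd p) \<partial>(\<mu> \<Otimes>\<^sub>M \<mu>)) = (\<lambda>z. energy t (slab_slice P F z \<delta>))"
    unfolding energy_def by (intro ext nn_integral_cong) (auto simp: slab_slice_def indicator_def)
  finally show "(\<lambda>z. energy t (slab_slice P F z \<delta>)) \<in> borel_measurable borel" .
qed

lemma sets_heavy:
  assumes P: "subspace P" and F: "F \<in> sets borel"
  shows "heavy t a b P F \<delta> \<in> sets borel"
proof -
  note [measurable] = borel_measurable_slab_slice[OF P F]
  have "{z \<in> space borel. ennreal (b * \<delta> ^ (CARD('n) - 2)) +
      ennreal (a / \<delta> ^ (CARD('n) - 2)) * energy t (slab_slice P F z \<delta>) < emeasure \<mu> (slab_slice P F z \<delta>)} \<in> sets borel"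
    by measurable
  thus ?thesis by (simp add: heavy_def)
qed

text \<open>
  By Fubini, the integral is the \<open>\<mu>\<close>-average over \<open>x\<close> of the volume of the slab of width \<open>\<delta>\<close> around
  \<open>x\<close>. The same exchange gives the bound for the energy in the next lemma, where two
  points of one slice have projections at distance at most \<open>2 * \<delta>\<close>.
\<close>

lemma nn_integral_mass_ge:
  fixes P :: "(real^'n) set"
  assumes P: "subspace P" "dim P = 2" and F: "F \<in> sets borel" "F \<subseteq> cball 0 B" "emeasure \<mu> F = 1"
    and \<delta>: "0 < \<delta>" "\<delta> \<le> 1"
  shows "ennreal ((2 / CARD('n))\<^sup>2 * (2 / CARD('n)) ^ (CARD('n) - 2) * \<delta> ^ (CARD('n) - 2))
    \<le> (\<integral>\<^sup>+z. indicator (cball 0 (B + 1)) z * emeasure \<mu> (slab_slice P F z \<delta>) \<partial>lborel)"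
proof -
  interpret LM: pair_sigma_finite "lborel :: (real^'n) measure" \<mu> ..
  have [measurable]: "perp P \<in> borel_measurable borel"
    using borel_measurable_perp[OF P(1), of "\<lambda>v. v" borel] by simp
  note [measurable] = F(1)
  let ?K = "cball (0::real^'n) (B + 1)"
  have [measurable]: "?K \<in> sets borel" by (intro borel_closed closed_cball)
  have AEF: "AE x in \<mu>. x \<in> F"
    using F by (intro AE_prob_1) (simp add: emeasure_eq_measure)
  define h :: "real^'n \<Rightarrow> real^'n \<Rightarrow> ennreal" where
    "h z x = (if z \<in> ?K \<and> x \<in> F \<and> norm (perp P (z - x)) \<le> \<delta> then 1 else 0)" for z x
  have hm: "case_prod h \<in> borel_measurable (lborel \<Otimes>\<^sub>M \<mu>)"
    unfolding h_def case_prod_beta by measurable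
  let ?c = "ennreal ((2 / CARD('n))\<^sup>2 * (2 / CARD('n)) ^ (CARD('n) - 2) * \<delta> ^ (CARD('n) - 2))"
  have "?c = (\<integral>\<^sup>+x. ?c \<partial>\<mu>)" by (simp add: emeasure_space_1)
  also have "\<dots> \<le> (\<integral>\<^sup>+x. (\<integral>\<^sup>+z. h z x \<partial>lborel) \<partial>\<mu>)"
  proof (rule nn_integral_mono_AE)
    show "AE x in \<mu>. ?c \<le> (\<integral>\<^sup>+z. h z x \<partial>lborel)"
      using AEF
    proof eventually_elim
      case (elim x)
      hence x: "norm x \<le> B" using F(2) by auto
      have "?c = ennreal ((2 / CARD('n))\<^sup>2 * (2 * (\<delta> / CARD('n))) ^ (CARD('n) - 2))"
        by (simp add: power_mult_distrib power_divide mult.assoc)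
      also have "\<dots> \<le> emeasure lborel {z \<in> ?K. norm (perp P (z - x)) \<le> \<delta>}"
        by (rule emeasure_lborel_slab_ge[OF P \<delta> x])
      also have "\<dots> = (\<integral>\<^sup>+z. indicator {z \<in> ?K. norm (perp P (z - x)) \<le> \<delta>} z \<partial>lborel)"
        using sets_slab[OF P(1)] by simp
      also have "\<dots> = (\<integral>\<^sup>+z. h z x \<partial>lborel)"
        using elim by (intro nn_integral_cong) (auto simp: h_def indicator_def)
      finally show ?case .
    qed
  qed
  also have "\<dots> = (\<integral>\<^sup>+z. (\<integral>\<^sup>+x. h z x \<partial>\<mu>) \<partial>lborel)"
    by (rule LM.Fubini'[OF hm])
  also have "\<dots> = (\<integral>\<^sup>+z. indicator ?K z * emeasure \<mu> (slab_slice P F z \<delta>) \<partial>lborel)"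
  proof (rule nn_integral_cong)
    fix z
    have "(\<integral>\<^sup>+x. h z x \<partial>\<mu>) = (\<integral>\<^sup>+x. indicator ?K z * indicator (slab_slice P F z \<delta>) x \<partial>\<mu>)"
      by (intro nn_integral_cong) (auto simp: slab_slice_def indicator_def h_def)
    also have "\<dots> = indicator ?K z * emeasure \<mu> (slab_slice P F z \<delta>)"
      using sets_slab_slice[OF P(1) F(1)] by (intro nn_integral_cmult_indicator) (simp add: sets_mu)
    finally show "(\<integral>\<^sup>+x. h z x \<partial>\<mu>) = \<dots>" .
  qed
  finally show ?thesis .
qed

lemma nn_integral_energy_le:
  fixes P :: "(real^'n) set"
  assumes P: "subspace P" "dim P = 2" and F: "F \<in> sets borel" and R: "R \<ge> 0" and \<delta>: "0 < \<delta>"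
  shows "(\<integral>\<^sup>+z. indicator (cball 0 R) z * energy t (slab_slice P F z \<delta>) \<partial>lborel)
    \<le> ennreal ((2*R)\<^sup>2 * (2*\<delta>) ^ (CARD('n) - 2)) * slab_energy t P (2 * \<delta>)"
proof -
  interpret MM: pair_prob_space \<mu> \<mu> ..
  interpret LM: pair_sigma_finite "lborel :: (real^'n) measure" "\<mu> \<Otimes>\<^sub>M \<mu>" ..
  have [measurable]: "perp P \<in> borel_measurable borel"
    using borel_measurable_perp[OF P(1), of "\<lambda>v. v" borel] by simp
  note [measurable] = F(1)
  let ?K = "cball (0::real^'n) R"
  have [measurable]: "?K \<in> sets borel" by (intro borel_closed closed_cball)
  let ?c = "ennreal ((2*R)\<^sup>2 * (2*\<delta>) ^ (CARD('n) - 2))"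
  define h :: "real^'n \<Rightarrow> (real^'n) \<times> (real^'n) \<Rightarrow> ennreal" where
    "h z p = (if z \<in> ?K \<and> fst p \<in> F \<and> norm (perp P (z - fst p)) \<le> \<delta> \<and> snd p \<in> F \<and> norm (perp P (z - snd p)) \<le> \<delta>
      then 1 else 0) * riesz t (fst p - snd p)" for z p
  have hm: "case_prod h \<in> borel_measurable (lborel \<Otimes>\<^sub>M (\<mu> \<Otimes>\<^sub>M \<mu>))"
    unfolding h_def case_prod_beta by measurable
  have "(\<integral>\<^sup>+z. indicator ?K z * energy t (slab_slice P F z \<delta>) \<partial>lborel) =
      (\<integral>\<^sup>+z. (\<integral>\<^sup>+p. h z p \<partial>(\<mu> \<Otimes>\<^sub>M \<mu>)) \<partial>lborel)"
  proof (rule nn_integral_cong)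
    fix z
    have S: "slab_slice P F z \<delta> \<in> sets borel" by (rule sets_slab_slice[OF P(1) F])
    note [measurable] = S
    have "indicator ?K z * energy t (slab_slice P F z \<delta>) =
      (\<integral>\<^sup>+p. indicator ?K z * (indicator (slab_slice P F z \<delta> \<times> slab_slice P F z \<delta>) p * riesz t (fst p - snd p)) \<partial>(\<mu> \<Otimes>\<^sub>M \<mu>))"
      unfolding energy_def by (rule nn_integral_cmult[symmetric]) measurable
    also have "\<dots> = (\<integral>\<^sup>+p. h z p \<partial>(\<mu> \<Otimes>\<^sub>M \<mu>))"
      by (intro nn_integral_cong) (auto simp: slab_slice_def indicator_def h_def)
    finally show "indicator ?K z * energy t (slab_slice P F z \<delta>) = (\<integral>\<^sup>+p. h z p \<partial>(\<mu> \<Otimes>\<^sub>M \<mu>))" .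
  qed
  also have "\<dots> = (\<integral>\<^sup>+p. (\<integral>\<^sup>+z. h z p \<partial>lborel) \<partial>(\<mu> \<Otimes>\<^sub>M \<mu>))"
    by (rule LM.Fubini'[OF hm, symmetric])
  also have "\<dots> \<le> (\<integral>\<^sup>+p. ?c * (indicator {v. norm (perp P v) \<le> 2 * \<delta>} (fst p - snd p) * riesz t (fst p - snd p)) \<partial>(\<mu> \<Otimes>\<^sub>M \<mu>))"
  proof (rule nn_integral_mono)
    fix p :: "(real^'n) \<times> (real^'n)"
    let ?S = "{z \<in> ?K. norm (perp P (z - fst p)) \<le> \<delta>}"
    show "(\<integral>\<^sup>+z. h z p \<partial>lborel) \<le> ?c * (indicator {v. norm (perp P v) \<le> 2 * \<delta>} (fst p - snd p) * riesz t (fst p - snd p))"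
    proof (cases "norm (perp P (fst p - snd p)) \<le> 2 * \<delta>")
      case True
      have "(\<integral>\<^sup>+z. h z p \<partial>lborel) \<le> (\<integral>\<^sup>+z. riesz t (fst p - snd p) * indicator ?S z \<partial>lborel)"
        by (intro nn_integral_mono) (auto simp: h_def indicator_def)
      also have "\<dots> = riesz t (fst p - snd p) * emeasure lborel ?S"
        using sets_slab[OF P(1)] by (intro nn_integral_cmult_indicator) simp
      also have "\<dots> \<le> riesz t (fst p - snd p) * ?c"
        using \<delta> R by (intro mult_left_mono emeasure_lborel_slab_le[OF P]) auto
      finally show ?thesis using True by (simp add: mult.commute)
    next
      case False
      have "h z p = 0" for z
      proof -
        have "norm (perp P (fst p - snd p)) \<le> norm (perp P (z - fst p)) + norm (perp P (z - snd p))"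
        proof -
          have "perp P (fst p - snd p) = perp P (z - snd p) - perp P (z - fst p)"
            using perp_diff[OF P(1), of "z - snd p" "z - fst p"] by simp
          thus ?thesis using norm_triangle_ineq4[of "perp P (z - snd p)" "perp P (z - fst p)"] by simp
        qed
        hence "\<not> (norm (perp P (z - fst p)) \<le> \<delta> \<and> norm (perp P (z - snd p)) \<le> \<delta>)" using False by linarith
        thus ?thesis by (auto simp: h_def)
      qed
      thus ?thesis by simp
    qed
  qed
  also have "\<dots> = ?c * slab_energy t P (2 * \<delta>)"
    unfolding slab_energy_def by (rule nn_integral_cmult) measurable
  finally show ?thesis .
qed

text \<open>
  On points that are not heavy the mass is at most \<open>b * \<delta>\<^sup>m + (a / \<delta>\<^sup>m) * energy\<close>, and the constants
  are chosen so that this accounts for at most half of the lower bound \<open>c1 * \<delta>\<^sup>m\<close> for the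
  integral of the mass. The other half must come from heavy points. There the mass itself is at
  most \<open>D * \<delta>\<^sup>m\<close>, because the energy dominates the square of the mass, so the heavy points
  fill a set of measure at least \<open>c1 / (2 * D)\<close>.
\<close>

lemma heavy_slices_positive_measure:
  fixes P :: "(real^'n) set"
  assumes P: "subspace P" "dim P = 2" and F: "F \<in> sets borel" "F \<subseteq> cball 0 B" "emeasure \<mu> F = 1"
    and B: "B > 0" and t: "t \<ge> 0" and M: "M > 0"
  shows "\<exists>a>0. \<exists>b>0. \<exists>l>0. \<forall>\<delta>. 0 < \<delta> \<longrightarrow> \<delta> \<le> 1 \<longrightarrow>
    slab_energy t P (2 * \<delta>) \<le> ennreal (M * \<delta> ^ (CARD('n) - 2)) \<longrightarrow>
    ennreal l \<le> emeasure lborel (cball 0 (B + 1) \<inter> heavy t a b P F \<delta>)"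
proof -
  let ?m = "CARD('n) - 2"
  let ?K = "cball (0::real^'n) (B + 1)"
  define c1 where "c1 = (2 / CARD('n))\<^sup>2 * (2 / CARD('n)) ^ ?m"
  define c2 where "c2 = (2 * (B + 1))\<^sup>2 * 2 ^ ?m"
  define L where "L = measure lborel ?K"
  have [measurable]: "?K \<in> sets borel" by (intro borel_closed closed_cball)
  have c: "c1 > 0" "c2 > 0" using B by (auto simp: c1_def c2_def)
  have LK: "emeasure lborel ?K = ennreal L"
    unfolding L_def by (rule emeasure_eq_ennreal_measure) (use emeasure_lborel_cball_finite[of "0::real^'n" "B + 1"] in auto)
  have L: "L > 0" unfolding L_def using content_cball_pos[of "B + 1" "0::real^'n"] B by simp
  \<comment> \<open>each of the two terms contributes a quarter of \<open>c1\<close>\<close>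
  define a where "a = c1 / (4 * c2 * M)"
  define b where "b = c1 / (4 * L)"
  define D where "D = (2 * B) powr t / a"
  have ab: "a > 0" "b > 0" using c M L by (auto simp: a_def b_def)
  have D: "D > 0" using B ab by (simp add: D_def)
  have "ennreal (c1 / (2 * D)) \<le> emeasure lborel (?K \<inter> heavy t a b P F \<delta>)"
    if \<delta>: "0 < \<delta>" "\<delta> \<le> 1" and E: "slab_energy t P (2 * \<delta>) \<le> ennreal (M * \<delta> ^ ?m)" for \<delta>
  proof -
    define A where "A = ?K \<inter> heavy t a b P F \<delta>"
    define u where "u z = emeasure \<mu> (slab_slice P F z \<delta>)" for z
    define G where "G z = energy t (slab_slice P F z \<delta>)" for z
    define d where "d = \<delta> ^ ?m"
    have d: "d > 0" using \<delta> by (simp add: d_def)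
    have [measurable]: "u \<in> borel_measurable borel" "G \<in> borel_measurable borel"
      using borel_measurable_slab_slice[OF P(1) F(1)] by (auto simp: u_def[abs_def] G_def[abs_def])
    have [measurable]: "A \<in> sets borel" unfolding A_def using sets_heavy[OF P(1) F(1)] by auto
    have uA: "u z \<le> ennreal (D * d)" if "z \<in> A" for z
    proof -
      let ?S = "slab_slice P F z \<delta>"
      define x where "x = measure \<mu> ?S"
      have ux: "u z = ennreal x" by (simp add: u_def x_def emeasure_eq_measure)
      have x0: "x \<ge> 0" by (simp add: x_def)
      have "ennreal (a / d) * G z \<le> ennreal (b * d) + ennreal (a / d) * G z" by simp
      also have "\<dots> \<le> u z" using that by (auto simp: A_def heavy_def u_def G_def d_def intro: less_imp_le)
      finally have 1: "ennreal (a / d) * G z \<le> ennreal x" by (simp add: ux)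
      have dS: "norm (y - y') \<le> 2 * B" if "y \<in> ?S" "y' \<in> ?S" for y y'
      proof -
        have "norm y \<le> B" "norm y' \<le> B" using that F(2) by (auto simp: slab_slice_def)
        thus ?thesis using norm_triangle_ineq4[of y y'] by linarith
      qed
      have "ennreal ((2 * B) powr (- t)) * (emeasure \<mu> ?S)\<^sup>2 \<le> energy t ?S"
        by (rule energy_ge[OF sets_slab_slice[OF P(1) F(1)] dS t])
      hence "ennreal ((2 * B) powr (- t)) * (ennreal x)\<^sup>2 \<le> G z" by (simp add: G_def ux[unfolded u_def])
      hence "ennreal (a / d) * (ennreal ((2 * B) powr (- t)) * (ennreal x)\<^sup>2) \<le> ennreal (a / d) * G z"
        by (intro mult_left_mono) auto
      also note 1
      also have "ennreal (a / d) * (ennreal ((2 * B) powr (- t)) * (ennreal x)\<^sup>2) = ennreal (a / d * ((2 * B) powr (- t) * x\<^sup>2))"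
      proof -
        have "ennreal (a / d * ((2 * B) powr (- t) * x\<^sup>2)) = ennreal (a / d) * ennreal ((2 * B) powr (- t) * x\<^sup>2)"
          using ab d by (intro ennreal_mult) auto
        also have "ennreal ((2 * B) powr (- t) * x\<^sup>2) = ennreal ((2 * B) powr (- t)) * ennreal (x\<^sup>2)"
          by (intro ennreal_mult) auto
        finally show ?thesis using x0 by (simp only: ennreal_power)
      qed
      finally have "a / d * ((2 * B) powr (- t) * x\<^sup>2) \<le> x" using x0 by simp
      hence 2: "(a / (d * (2 * B) powr t)) * x * x \<le> 1 * x" by (simp add: powr_minus power2_eq_square field_simps)
      have "x \<le> D * d"
      proof (cases "x = 0")
        case False
        hence "(a / (d * (2 * B) powr t)) * x \<le> 1" using 2 x0 by (intro mult_right_le_imp_le[OF 2]) auto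
        thus ?thesis using ab d B by (simp add: D_def field_simps)
      qed (use D d in auto)
      thus ?thesis by (simp add: ux ennreal_leI)
    qed
    have Afin: "emeasure lborel A \<le> ennreal L"
      unfolding LK[symmetric] by (rule emeasure_mono) (auto simp: A_def)
    then obtain l where l: "l \<ge> 0" "emeasure lborel A = ennreal l"
      by (metis ennreal_cases ennreal_less_top leD top_greatest)
    have "ennreal (c1 * d) \<le> (\<integral>\<^sup>+z. indicator ?K z * u z \<partial>lborel)"
      using nn_integral_mass_ge[OF P F \<delta>] by (simp add: c1_def d_def u_def)
    also have "\<dots> \<le> (\<integral>\<^sup>+z. (ennreal (D * d) * indicator A z + ennreal (b * d) * indicator ?K z) +
        ennreal (a / d) * (indicator ?K z * G z) \<partial>lborel)"
    proof (rule nn_integral_mono)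
      fix z
      show "indicator ?K z * u z \<le> (ennreal (D * d) * indicator A z + ennreal (b * d) * indicator ?K z) +
        ennreal (a / d) * (indicator ?K z * G z)"
      proof (cases "z \<in> ?K")
        case K: True
        show ?thesis
        proof (cases "z \<in> A")
          case True
          have "u z \<le> ennreal (D * d) + (ennreal (b * d) + ennreal (a / d) * G z)"
            using uA[OF True] by (rule add_increasing2[rotated]) simp
          thus ?thesis using True K by (simp add: add.assoc)
        next
          case False
          hence "u z \<le> ennreal (b * d) + ennreal (a / d) * G z"
            using K by (auto simp: A_def heavy_def u_def G_def d_def not_less)
          thus ?thesis using False K by simp
        qed
      qed simp
    qed
    also have "\<dots> = (ennreal (D * d) * emeasure lborel A + ennreal (b * d) * emeasure lborel ?K) +
        ennreal (a / d) * (\<integral>\<^sup>+z. indicator ?K z * G z \<partial>lborel)"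
      by (simp add: nn_integral_add nn_integral_cmult nn_integral_cmult_indicator)
    also have "\<dots> \<le> (ennreal (D * d) * ennreal l + ennreal (b * d) * ennreal L) +
        ennreal (a / d) * (ennreal (c2 * d) * ennreal (M * d))"
    proof -
      have "(\<integral>\<^sup>+z. indicator ?K z * G z \<partial>lborel) \<le> ennreal ((2 * (B + 1))\<^sup>2 * (2 * \<delta>) ^ ?m) * slab_energy t P (2 * \<delta>)"
        unfolding G_def using B \<delta> by (intro nn_integral_energy_le[OF P F(1)]) auto
      also have "(2 * (B + 1))\<^sup>2 * (2 * \<delta>) ^ ?m = c2 * d" by (simp add: c2_def d_def power_mult_distrib)
      also have "ennreal (c2 * d) * slab_energy t P (2 * \<delta>) \<le> ennreal (c2 * d) * ennreal (M * d)"
        using E by (intro mult_left_mono) (auto simp: d_def)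
      finally show ?thesis unfolding l(2) LK by (intro add_left_mono mult_left_mono) auto
    qed
    also have "\<dots> = ennreal (D * d * l + b * d * L + a / d * (c2 * d * (M * d)))"
    proof -
      have "(ennreal p * ennreal l' + ennreal p' * ennreal L') + ennreal r * (ennreal s * ennreal w) =
          ennreal (p * l' + p' * L' + r * (s * w))"
        if "0 \<le> p" "0 \<le> l'" "0 \<le> p'" "0 \<le> L'" "0 \<le> r" "0 \<le> s" "0 \<le> w" for p l' p' L' r s w
        using that by (simp add: ennreal_mult ennreal_plus)
      thus ?thesis using D d l(1) ab L c M by simp
    qed
    finally have "c1 * d \<le> D * d * l + b * d * L + a / d * (c2 * d * (M * d))"
      using D d l ab L c M by (subst (asm) ennreal_le_iff) auto
    also have "\<dots> = (D * l + b * L + a * (c2 * M)) * d" using d by (simp add: field_simps)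
    finally have "c1 \<le> D * l + b * L + a * (c2 * M)" using d by simp
    also have "b * L = c1 / 4" using L by (simp add: b_def)
    also have "a * (c2 * M) = c1 / 4" using c M by (simp add: a_def)
    finally have "c1 / (2 * D) \<le> l" using D by (simp add: field_simps)
    thus ?thesis using l by (simp add: A_def ennreal_leI)
  qed
  moreover have "c1 / (2 * D) > 0" using c D by simp
  ultimately show ?thesis using ab by blast
qed

end

section \<open>Dimension of slices through frequently heavy points\<close>

text \<open>
  The distance from \<open>z + P\<close> attains a positive minimum on the compact set \<open>F - W\<close>.
\<close>

lemma slab_slices_eventually_subset:
  fixes F :: "(real^'n) set"
  assumes P: "subspace P" and F: "compact F" and W: "open W" "{x \<in> F. perp P (z - x) = 0} \<subseteq> W"
  shows "\<exists>\<eta>>0. \<forall>\<delta><\<eta>. slab_slice P F z \<delta> \<subseteq> W"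
proof (cases "F - W = {}")
  case True
  thus ?thesis by (intro exI[of _ 1]) (auto simp: slab_slice_def)
next
  case False
  have "compact (F - W)" using F W(1) by (rule compact_diff)
  moreover have "continuous_on (F - W) (\<lambda>x. norm (perp P (z - x)))"
    by (intro continuous_intros P)
  ultimately obtain x0 where x0: "x0 \<in> F - W" "\<And>x. x \<in> F - W \<Longrightarrow> norm (perp P (z - x0)) \<le> norm (perp P (z - x))"
    using continuous_attains_inf[of "F - W" "\<lambda>x. norm (perp P (z - x))"] False by blast
  show ?thesis
  proof (intro exI[of _ "norm (perp P (z - x0))"] conjI allI impI)
    show "norm (perp P (z - x0)) > 0" using x0(1) W(2) by auto
    show "slab_slice P F z \<delta> \<subseteq> W" if "\<delta> < norm (perp P (z - x0))" for \<delta>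
    proof
      fix x assume x: "x \<in> slab_slice P F z \<delta>"
      show "x \<in> W"
      proof (rule ccontr)
        assume "x \<notin> W"
        hence "norm (perp P (z - x0)) \<le> norm (perp P (z - x))" using x by (intro x0(2)) (auto simp: slab_slice_def)
        thus False using x \<open>\<delta> < norm (perp P (z - x0))\<close> by (simp add: slab_slice_def)
      qed
    qed
  qed
qed

context frostman
begin

text \<open>
  The energy bound for covers is used with \<open>\<beta> = \<delta>\<^sup>m / (4 * a)\<close>, for which its energy term is exactly the
  one in the definition of \<open>heavy\<close> and cancels. That term is finite, since it is less than the mass.
\<close>

lemma heavy_cover_sum_ge:
  fixes P :: "(real^'n) set"
  assumes z: "z \<in> heavy t a b P F \<delta>" and ab: "a > 0" "b > 0" and \<delta>: "\<delta> > 0" and t: "t \<ge> 0"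
    and P: "subspace P" and F: "F \<in> sets borel"
    and I: "finite I" "slab_slice P F z \<delta> \<subseteq> (\<Union>i\<in>I. V i)"
    and V: "\<And>i. V i \<in> sets borel" and \<rho>: "\<And>i x y. x \<in> V i \<Longrightarrow> y \<in> V i \<Longrightarrow> norm (x - y) \<le> \<rho> i" "\<And>i. \<rho> i > 0"
  shows "4 * a * b < (\<Sum>i\<in>I. \<rho> i powr t)"
proof -
  let ?S = "slab_slice P F z \<delta>"
  define d where "d = \<delta> ^ (CARD('n) - 2)"
  define \<beta> where "\<beta> = d / (4 * a)"
  have d: "d > 0" using \<delta> by (simp add: d_def)
  have \<beta>: "\<beta> > 0" "1 / (4 * \<beta>) = a / d" using d ab by (auto simp: \<beta>_def)
  let ?E = "ennreal (a / d) * energy t ?S"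
  have lt: "ennreal (b * d) + ?E < emeasure \<mu> ?S" using z by (simp add: heavy_def d_def)
  also have "emeasure \<mu> ?S \<le> ennreal (\<beta> * (\<Sum>i\<in>I. \<rho> i powr t)) + ?E"
    using emeasure_le_cover_energy[OF I(1) sets_slab_slice[OF P F] I(2) V \<rho> t \<beta>(1)] by (simp only: \<beta>(2))
  finally have "ennreal (b * d) + ?E < ennreal (\<beta> * (\<Sum>i\<in>I. \<rho> i powr t)) + ?E" .
  hence "ennreal (b * d) < ennreal (\<beta> * (\<Sum>i\<in>I. \<rho> i powr t))"
    by (meson add_right_mono not_le)
  hence "b * d < \<beta> * (\<Sum>i\<in>I. \<rho> i powr t)"
    using ab d by (subst (asm) ennreal_less_iff) auto
  thus ?thesis using ab d by (simp add: \<beta>_def field_simps)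
qed

text \<open>
  If the \<open>s\<close>-dimensional measure of the slice vanished for some \<open>s < t\<close>, the slice would have an open
  cover with sum at most \<open>4 * a * b\<close>; finitely many of its sets would cover a thin heavy slab as well.
\<close>

lemma hausdorff_dim_slice_ge:
  fixes P :: "(real^'n) set"
  assumes P: "subspace P" and F: "compact F" and ab: "a > 0" "b > 0" and t: "t > 0"
    and \<delta>: "\<And>k. \<delta> k > 0" "\<delta> \<longlonglongrightarrow> 0"
    and z: "\<exists>\<^sub>F k in sequentially. z \<in> heavy t a b P F (\<delta> k)"
  shows "ereal t \<le> hausdorff_dim {x \<in> F. perp P (z - x) = 0}"
proof -
  let ?S = "{x \<in> F. perp P (z - x) = 0}"
  have Fb: "F \<in> sets borel" using F by (simp add: borel_closed compact_imp_closed)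
  have cS: "compact ?S"
  proof -
    have "continuous_on UNIV (\<lambda>x. perp P (z - x))" by (intro continuous_intros P)
    hence "closed {x. perp P (z - x) = 0}" by (intro closed_Collect_eq) auto
    from compact_Int_closed[OF F this] show ?thesis by (simp add: Int_def)
  qed
  have "t \<le> s" if s: "0 \<le> s" "hausdorff_measure s ?S = 0" for s
  proof (rule ccontr)
    assume "\<not> t \<le> s"
    hence st: "s \<le> t" by simp
    have \<epsilon>: "4 * a * b > 0" using ab by simp
    obtain V :: "nat \<Rightarrow> (real^'n) set" and \<rho> where V: "?S \<subseteq> (\<Union>i. V i)" "\<forall>i. open (V i)" "\<forall>i. \<rho> i > 0"
      "\<forall>i. \<forall>x\<in>V i. \<forall>y\<in>V i. norm (x - y) \<le> \<rho> i"
      "(\<Sum>i. ennreal (\<rho> i powr t)) \<le> ennreal (4 * a * b)"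
      using hausdorff_null_imp_open_cover[OF s(2,1) st t \<epsilon>] by blast
    obtain I where I: "finite I" "?S \<subseteq> (\<Union>i\<in>I. V i)"
      using compactE_image[OF cS, of UNIV V] V(1,2) by auto
    have "open (\<Union>i\<in>I. V i)" using V(2) by auto
    then obtain \<eta> where \<eta>: "\<eta> > 0" "\<forall>\<delta><\<eta>. slab_slice P F z \<delta> \<subseteq> (\<Union>i\<in>I. V i)"
      using slab_slices_eventually_subset[OF P F _ I(2)] by blast
    have "\<forall>\<^sub>F k in sequentially. \<delta> k < \<eta>" using \<delta>(2) \<eta>(1) by (rule order_tendstoD)
    then obtain N where N: "\<And>k. k \<ge> N \<Longrightarrow> \<delta> k < \<eta>" by (auto simp: eventually_sequentially)
    obtain k where k: "z \<in> heavy t a b P F (\<delta> k)" "\<delta> k < \<eta>"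
      using z N by (auto simp: frequently_sequentially)
    have "4 * a * b < (\<Sum>i\<in>I. \<rho> i powr t)"
      using k V t by (intro heavy_cover_sum_ge[OF k(1) ab \<delta>(1) _ P Fb I(1) \<eta>(2)[rule_format]]) auto
    moreover have "ennreal (\<Sum>i\<in>I. \<rho> i powr t) \<le> ennreal (4 * a * b)"
    proof -
      have "ennreal (\<Sum>i\<in>I. \<rho> i powr t) = (\<Sum>i\<in>I. ennreal (\<rho> i powr t))"
        by (rule sum_ennreal[symmetric]) simp
      also have "\<dots> \<le> (\<Sum>i. ennreal (\<rho> i powr t))"
        by (rule sum_le_suminf) (use I in auto)
      finally show ?thesis using V(5) by simp
    qed
    ultimately show False using \<epsilon> by (simp add: ennreal_le_iff)
  qed
  thus ?thesis unfolding hausdorff_dim_def by (intro INF_greatest) auto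
qed

end

section \<open>Points that are heavy at infinitely many scales\<close>

text \<open>
  The set is the intersection of the decreasing unions \<open>\<Union>k\<ge>n. A k\<close>, each of measure at least \<open>l\<close>;
  the common bound \<open>K\<close> gives continuity of the measure from above.
\<close>

lemma emeasure_frequently_ge:
  assumes A: "\<And>k::nat. A k \<in> sets M" "\<And>k. A k \<subseteq> K" and K: "K \<in> sets M" "emeasure M K < \<infinity>"
    and l: "\<exists>\<^sub>F k in sequentially. l \<le> emeasure M (A k)"
  shows "l \<le> emeasure M {z. \<exists>\<^sub>F k in sequentially. z \<in> A k}"
proof -
  define B where "B n = (\<Union>k\<in>{n..}. A k)" for n
  have "{z. \<exists>\<^sub>F k in sequentially. z \<in> A k} = (\<Inter>n. B n)"
    by (auto simp: B_def frequently_sequentially)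
  moreover have "emeasure M (\<Inter>n. B n) = (INF n. emeasure M (B n))"
  proof (rule INF_emeasure_decseq[symmetric])
    show "range B \<subseteq> sets M" using A(1) by (auto simp: B_def)
    show "decseq B" unfolding B_def decseq_def by (intro allI impI UN_mono) auto
    fix n
    have "emeasure M (B n) \<le> emeasure M K" using A(2) K(1) by (intro emeasure_mono) (auto simp: B_def)
    thus "emeasure M (B n) \<noteq> \<infinity>" using K(2) by auto
  qed
  moreover have "l \<le> emeasure M (B n)" for n
  proof -
    obtain k where k: "k \<ge> n" "l \<le> emeasure M (A k)"
      using l by (auto simp: frequently_sequentially)
    have "emeasure M (A k) \<le> emeasure M (B n)"
      using k(1) A(1) by (intro emeasure_mono) (auto simp: B_def)
    thus ?thesis using k(2) by simp
  qed
  ultimately show ?thesis by (simp add: INF_greatest)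
qed

text \<open>
  The preimage of a set of diameter \<open>\<rho>\<close> under \<open>perp P\<close> lies in a slab of width \<open>\<rho>\<close>, whose part in a
  fixed ball has Lebesgue measure at most a constant times \<open>\<rho> ^ m\<close>. A null cover of the image would
  thus make \<open>G\<close> a Lebesgue null set. Working with \<open>G\<close> avoids Lebesgue measure on \<open>P\<^sup>\<bottom>\<close>.
\<close>

lemma hausdorff_measure_perp_image_pos:
  fixes P :: "(real^'n) set"
  assumes P: "subspace P" "dim P = 2" and m: "0 < CARD('n) - 2"
    and G: "G \<subseteq> cball 0 R" "0 < emeasure lborel G" and R: "R > 0"
  shows "0 < hausdorff_measure (real (CARD('n) - 2)) (perp P ` G)"
proof (rule ccontr)
  let ?m = "CARD('n) - 2"
  assume "\<not> ?thesis"
  hence H: "hausdorff_measure (real ?m) (perp P ` G) = 0" by simp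
  define c where "c = (2 * R)\<^sup>2 * 2 ^ ?m"
  have c: "c > 0" using R by (simp add: c_def)
  obtain l where l: "l > 0" "ennreal l \<le> emeasure lborel G"
  proof (cases "emeasure lborel G = \<top>")
    case True
    thus ?thesis using that[of 1] by simp
  next
    case False
    then obtain x where "x \<ge> 0" "emeasure lborel G = ennreal x" by (metis ennreal_cases)
    thus ?thesis using that[of x] G(2) by (auto simp: order_le_less)
  qed
  have \<epsilon>: "l / (2 * c) > 0" using l c by simp
  have m': "0 \<le> real ?m" "real ?m \<le> real ?m" "0 < real ?m" using m by auto
  obtain V :: "nat \<Rightarrow> (real^'n) set" and \<rho> where V: "perp P ` G \<subseteq> (\<Union>i. V i)" "\<forall>i. open (V i)" "\<forall>i. \<rho> i > 0"
      "\<forall>i. \<forall>x\<in>V i. \<forall>y\<in>V i. norm (x - y) \<le> \<rho> i"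
      "(\<Sum>i. ennreal (\<rho> i powr ?m)) \<le> ennreal (l / (2 * c))"
    using hausdorff_null_imp_open_cover[OF H m' \<epsilon>] by blast
  \<comment> \<open>the centre is an arbitrary point when \<open>V i\<close> misses the range of \<open>perp P\<close>\<close>
  define S where "S i = {z \<in> cball 0 R. norm (perp P (z - (SOME x. perp P x \<in> V i))) \<le> \<rho> i}" for i
  have Sb: "S i \<in> sets borel" for i unfolding S_def by (rule sets_slab[OF P(1)])
  have "G \<subseteq> (\<Union>i. S i)"
  proof
    fix z assume z: "z \<in> G"
    then obtain i where i: "perp P z \<in> V i" using V(1) by blast
    hence "perp P (SOME x. perp P x \<in> V i) \<in> V i" by (rule someI)
    hence "norm (perp P z - perp P (SOME x. perp P x \<in> V i)) \<le> \<rho> i" using i V(4) by blast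
    hence "z \<in> S i" using z G(1) by (auto simp: S_def perp_diff[OF P(1)])
    thus "z \<in> (\<Union>i. S i)" by blast
  qed
  hence "emeasure lborel G \<le> emeasure lborel (\<Union>i. S i)" using Sb by (intro emeasure_mono) auto
  also have "\<dots> \<le> (\<Sum>i. emeasure lborel (S i))" using Sb by (intro emeasure_subadditive_countably) auto
  also have "\<dots> \<le> (\<Sum>i. ennreal c * ennreal (\<rho> i powr ?m))"
  proof (intro suminf_le allI)
    fix i
    have "emeasure lborel (S i) \<le> ennreal ((2 * R)\<^sup>2 * (2 * \<rho> i) ^ ?m)"
      unfolding S_def using R V(3)[rule_format, of i] by (intro emeasure_lborel_slab_le[OF P]) auto
    also have "(2 * R)\<^sup>2 * (2 * \<rho> i) ^ ?m = c * \<rho> i powr ?m"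
      using V(3)[rule_format, of i] by (simp add: c_def power_mult_distrib powr_realpow)
    also have "ennreal (c * \<rho> i powr ?m) = ennreal c * ennreal (\<rho> i powr ?m)"
      using c by (intro ennreal_mult) auto
    finally show "emeasure lborel (S i) \<le> ennreal c * ennreal (\<rho> i powr ?m)" .
  qed auto
  also have "\<dots> = ennreal c * (\<Sum>i. ennreal (\<rho> i powr ?m))" by simp
  also have "\<dots> \<le> ennreal c * ennreal (l / (2 * c))" by (intro mult_left_mono V(5)) simp
  also have "\<dots> = ennreal (l / 2)" using c l by (subst ennreal_mult[symmetric]) auto
  finally have "ennreal l \<le> ennreal (l / 2)" using l(2) by (rule order.trans[rotated])
  thus False using l(1) by (simp add: ennreal_le_iff)
qed

lemma translate_eq_fibre:
  assumes P: "subspace P"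
  shows "(\<lambda>p. perp P z + p) ` P = {x. perp P (z - x) = 0}"
proof (intro set_eqI iffI)
  have cz: "z - perp P z \<in> P" using closest_point_subspaceE(1)[OF P] by (simp add: perp_def)
  fix x
  show "x \<in> {x. perp P (z - x) = 0}" if "x \<in> (\<lambda>p. perp P z + p) ` P"
  proof -
    obtain p where p: "p \<in> P" "x = perp P z + p" using \<open>x \<in> (\<lambda>p. perp P z + p) ` P\<close> by blast
    have "z - x = (z - perp P z) - p" using p by simp
    hence "z - x \<in> P" using subspace_diff[OF P cz p(1)] by (simp only:)
    thus ?thesis using perp_eq_0_iff[OF P] by blast
  qed
  show "x \<in> (\<lambda>p. perp P z + p) ` P" if "x \<in> {x. perp P (z - x) = 0}"
  proof -
    have "z - x \<in> P" using \<open>x \<in> {x. perp P (z - x) = 0}\<close> perp_eq_0_iff[OF P] by blast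
    hence "(z - perp P z) - (z - x) \<in> P" using subspace_diff[OF P cz] by blast
    moreover have "x = perp P z + ((z - perp P z) - (z - x))" by simp
    ultimately show ?thesis by blast
  qed
qed

theorem proposition1p3:
  fixes e :: "real^'n"
    and F :: "(real^'n) set"
    and \<mu> :: "(real^'n) measure"
    and \<nu> :: "(real^'n) set measure"
    and C q t :: real
    and m :: nat
  assumes "CARD('n) \<ge> 3"
    and "m = CARD('n) - 2"
    and "e \<in> sphere 0 1"
    and "invariant_line_measure ({e}\<^sup>\<bottom>) \<nu>"
    and "compact F"
    and "sets \<mu> = sets borel"
    and "prob_space \<mu>"
    and "emeasure \<mu> F = 1"
    and "q > real m + 1"
    and "\<And>x r. r > 0 \<Longrightarrow> measure \<mu> (cball x r) \<le> C * r powr q"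
    and "0 < t"
    and "t < q - real m"
  shows "AE P in planes_through_measure e \<nu>.
    \<exists>Y \<subseteq> P\<^sup>\<bottom>. hausdorff_measure (real m) Y > 0 \<and>
      (\<forall>y\<in>Y. hausdorff_dim (F \<inter> (\<lambda>p. y + p) ` P) \<ge> ereal t)"
proof -
  interpret frostman \<mu> C q
    by (rule frostman.intro[OF assms(6,7,10)])
  have e: "norm e = 1" using assms(3) by simp
  have m: "0 < CARD('n) - 2" "real (CARD('n) - 2) + 1 < q" using assms(1,2,9) by auto
  have t: "0 < t" "t + real (CARD('n) - 2) < q" using assms(2,11,12) by auto
  have Fb: "F \<in> sets borel" using assms(5) by (simp add: borel_closed compact_imp_closed)
  have bF: "bounded F" using assms(5) by (rule compact_imp_bounded)
  obtain B where B: "B > 0" "F \<subseteq> cball 0 B" using bF unfolding bounded_pos by (metis mem_cball_0 subsetI)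
  define \<delta> where "\<delta> k = 1 / real (Suc k)" for k
  have \<delta>: "\<delta> k > 0" "\<delta> k \<le> 1" for k by (auto simp: \<delta>_def)
  have \<delta>0: "\<delta> \<longlonglongrightarrow> 0" unfolding \<delta>_def by (rule LIMSEQ_Suc[OF lim_1_over_n])
  have AE: "AE P in planes_through_measure e \<nu>. \<exists>M>0. \<exists>\<^sub>F k in sequentially.
      slab_energy t P (2 * \<delta> k) \<le> ennreal (M * (2 * \<delta> k) ^ (CARD('n) - 2))"
    by (rule AE_slab_energy[OF e assms(4) bF Fb assms(8) m t]) (use \<delta>(1) in simp)
  show ?thesis
    using AE AE_space
  proof eventually_elim
    case (elim P)
    have P: "subspace P" "dim P = 2"
      using elim(2) planes_throughD by (auto simp: planes_through_measure_def)
    obtain M where M: "M > 0"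
      "\<exists>\<^sub>F k in sequentially. slab_energy t P (2 * \<delta> k) \<le> ennreal (M * (2 * \<delta> k) ^ (CARD('n) - 2))"
      using elim(1) by blast
    define M' where "M' = M * 2 ^ (CARD('n) - 2)"
    have M': "M' > 0" using M(1) by (simp add: M'_def)
    have M'_eq: "M * (2 * \<delta> k) ^ (CARD('n) - 2) = M' * \<delta> k ^ (CARD('n) - 2)" for k
      by (simp add: M'_def power_mult_distrib)
    have fr: "\<exists>\<^sub>F k in sequentially. slab_energy t P (2 * \<delta> k) \<le> ennreal (M' * \<delta> k ^ (CARD('n) - 2))"
      using M(2) by (simp only: M'_eq)
    obtain a b l where abl: "a > 0" "b > 0" "l > 0"
      "\<forall>\<delta>. 0 < \<delta> \<longrightarrow> \<delta> \<le> 1 \<longrightarrow> slab_energy t P (2 * \<delta>) \<le> ennreal (M' * \<delta> ^ (CARD('n) - 2)) \<longrightarrow>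
        ennreal l \<le> emeasure lborel (cball 0 (B + 1) \<inter> heavy t a b P F \<delta>)"
      using heavy_slices_positive_measure[OF P Fb B(2) assms(8) B(1) less_imp_le[OF t(1)] M'] by blast
    define A where "A k = cball 0 (B + 1) \<inter> heavy t a b P F (\<delta> k)" for k
    define G where "G = {z. \<exists>\<^sub>F k in sequentially. z \<in> A k}"
    have "\<exists>\<^sub>F k in sequentially. ennreal l \<le> emeasure lborel (A k)"
      using fr by (rule frequently_elim1) (use abl(4) \<delta> in \<open>auto simp: A_def\<close>)
    hence "ennreal l \<le> emeasure lborel G"
      unfolding G_def
    proof (rule emeasure_frequently_ge[rotated -1])
      show "A k \<in> sets lborel" for k
        using sets_heavy[OF P(1) Fb] by (simp add: A_def sets.Int)
      show "emeasure lborel (cball (0::real^'n) (B + 1)) < \<infinity>"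
        using emeasure_lborel_cball_finite by simp
    qed (auto simp: A_def)
    hence G: "0 < emeasure lborel G" using abl(3) by (metis ennreal_less_zero_iff order.strict_trans2)
    have GA: "G \<subseteq> cball 0 (B + 1)" by (auto simp: G_def A_def dest!: frequently_ex)
    have zh: "\<exists>\<^sub>F k in sequentially. z \<in> heavy t a b P F (\<delta> k)" if "z \<in> G" for z
      using that unfolding G_def mem_Collect_eq by (rule frequently_elim1) (simp add: A_def)
    show ?case
    proof (intro exI[of _ "perp P ` G"] conjI ballI)
      show "perp P ` G \<subseteq> P\<^sup>\<bottom>" using perp_in_orthogonal_comp[OF P(1)] by auto
      show "0 < hausdorff_measure (real m) (perp P ` G)"
        unfolding assms(2) using B(1) by (intro hausdorff_measure_perp_image_pos[OF P m(1) GA G]) simp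
      fix y assume "y \<in> perp P ` G"
      then obtain z where z: "z \<in> G" "y = perp P z" by blast
      have "ereal t \<le> hausdorff_dim {x \<in> F. perp P (z - x) = 0}"
        by (rule hausdorff_dim_slice_ge[OF P(1) assms(5) abl(1,2) t(1) \<delta>(1) \<delta>0 zh[OF z(1)]])
      also have "{x \<in> F. perp P (z - x) = 0} = F \<inter> (\<lambda>p. y + p) ` P"
        using translate_eq_fibre[OF P(1), of z] z(2) by auto
      finally show "ereal t \<le> hausdorff_dim (F \<inter> (\<lambda>p. y + p) ` P)" .
    qed
  qed
qed

end
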